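(* Let $\mathcal{Q}$ be a finite classical polar space of rank $r\ge 1$, type $Q$ and parameter $\epsilon$ over $\mathbb{F}_q$ with ambient vector space $V$, let $1\le t\le k\le r$, let $D$ be a $t$-$(r,k,\lambda)_Q$ design in $\mathcal{Q}$, and let $H$ be a non-degenerate hyperplane of $V$. The restriction of $\mathcal{Q}$ to $H$ is a polar space $\mathcal{Q}'$ of some rank $r'\in\{r,r-1\}$ and some type $Q'$. Then the residual design of $D$ in $H$, $$\operatorname{Res}_H(D)=\{B\in D\mid B\subseteq H\},$$ is a $(t-1)$-$(r',k,\lambda')_{Q'}$ design in $\mathcal{Q}'$ with $$\lambda'=\begin{cases}\dfrac{[r-t+1]_q\,(q^{r-k+\epsilon}+1)}{[k-t+1]_q}\,\lambda & \text{if } r'=r,\\[3mm] \dfrac{(q^{r-t+1+\epsilon}+1)\,[r-k]_q}{[k-t+1]_q}\,\lambda & \text{if } r'=r-1.\end{cases}$$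
   Context: Let $q$ be a prime power. A finite classical polar space $\mathcal{Q}$ over $\mathbb{F}_q$ consists of all subspaces of a finite-dimensional $\mathbb{F}_q$-vector space $V$, $n=\dim V$, that are totally isotropic (resp. totally singular) with respect to a non-degenerate alternating or Hermitian form (resp. a non-singular quadratic form) on $V$. All dimensions are vector space dimensions. The rank $r$ is the maximal dimension of a subspace in $\mathcal{Q}$. The type $Q$ of $\mathcal{Q}$ (kind of form together with $q$) and its parameter $\epsilon$ are: symplectic $\mathrm{Sp}(q)$ ($n=2r$, $\epsilon=0$); Hermitian $U^+(q)$ ($q$ a square, $n=2r$, $\epsilon=-1/2$); Hermitian $U^-(q)$ ($q$ a square, $n=2r+1$, $\epsilon=1/2$); hyperbolic $\Omega^+(q)$ ($n=2r$, $\epsilon=-1$); parabolic $\Omega(q)$ ($n=2r+1$, $\epsilon=0$); elliptic $\Omega^-(q)$ ($n=2r+2$, $\epsilon=1$). $[m]_q=\frac{q^m-1}{q-1}$ for integers $m\ge 0$. A hyperplane $H$ of $V$ is degenerate if $H=P^\perp$ for some point (1-dimensional subspace) $P$ of $\mathcal{Q}$, where $\perp$ is taken with respect to the underlying form (for a quadratic form, its associated bilinear form); otherwise $H$ is non-degenerate. The restriction of $\mathcal{Q}$ to $H$ is the set of all subspaces of $\mathcal{Q}$ contained in $H$. For $t,k\in\{0,\ldots,r\}$ and an integer $\lambda\ge 0$, a $t$-$(r,k,\lambda)_Q$ design in $\mathcal{Q}$ is a set $D$ of $k$-dimensional subspaces of $\mathcal{Q}$ (called blocks) such that every $t$-dimensional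 subspace of $\mathcal{Q}$ is contained in exactly $\lambda$ elements of $D$. The same definition is used in $\mathcal{Q}'$, including rank $0$ and including the case $k=r>r'=r-1$, in which there are no $k$-dimensional subspaces of $\mathcal{Q}'$ and the design is the empty one (with $\lambda'=0$). *)

theory Defs
  imports Complex_Main "HOL-Library.Cardinality"
begin

text \<open>
  The ground field is a finite type \<open>'a\<close> of order \<open>q = CARD('a)\<close>. Ambient spaces are
  finite-dimensional subspaces \<open>V\<close> of an arbitrary vector space over \<open>'a\<close>, and every condition on
  a form is relativised to \<open>V\<close>, so that a form on \<open>V\<close> is literally also a form on a hyperplane
  of \<open>V\<close>.
\<close>

datatype ('a, 'b) form =
    Alternating "'b \<Rightarrow> 'b \<Rightarrow> 'a"
  | Hermitian "'b \<Rightarrow> 'b \<Rightarrow> 'a"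
  | Quadratic "'b \<Rightarrow> 'a"

definition linear_form_on :: "('a::field \<Rightarrow> 'b::ab_group_add \<Rightarrow> 'b) \<Rightarrow> 'b set \<Rightarrow> ('b \<Rightarrow> 'a) \<Rightarrow> bool"
  where "linear_form_on scale V g \<longleftrightarrow>
    (\<forall>x\<in>V. \<forall>y\<in>V. g (x + y) = g x + g y) \<and> (\<forall>a. \<forall>x\<in>V. g (scale a x) = a * g x)"

definition bilinear_form_on ::
    "('a::field \<Rightarrow> 'b::ab_group_add \<Rightarrow> 'b) \<Rightarrow> 'b set \<Rightarrow> ('b \<Rightarrow> 'b \<Rightarrow> 'a) \<Rightarrow> bool"
  where "bilinear_form_on scale V \<beta> \<longleftrightarrow>
    (\<forall>y\<in>V. linear_form_on scale V (\<lambda>x. \<beta> x y)) \<and> (\<forall>x\<in>V. linear_form_on scale V (\<beta> x))"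

fun sesquilinear_part :: "('a::field, 'b::ab_group_add) form \<Rightarrow> 'b \<Rightarrow> 'b \<Rightarrow> 'a" where
  "sesquilinear_part (Alternating \<beta>) x y = \<beta> x y"
| "sesquilinear_part (Hermitian h) x y = h x y"
| "sesquilinear_part (Quadratic Q) x y = Q (x + y) - Q x - Q y"

text \<open>
  In the Hermitian case \<open>q = s\<^sup>2\<close> and \<open>x \<mapsto> x ^ s\<close> is the involutory automorphism of the field;
  semilinearity in the second argument follows from linearity in the first.
\<close>

fun is_form_on ::
    "('a::{field,finite} \<Rightarrow> 'b::ab_group_add \<Rightarrow> 'b) \<Rightarrow> 'b set \<Rightarrow> ('a, 'b) form \<Rightarrow> bool" where
  "is_form_on scale V (Alternating \<beta>) \<longleftrightarrow>
     bilinear_form_on scale V \<beta> \<and> (\<forall>x\<in>V. \<beta> x x = 0)"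
| "is_form_on scale V (Hermitian h) \<longleftrightarrow>
     (\<forall>y\<in>V. linear_form_on scale V (\<lambda>x. h x y)) \<and>
     (\<exists>s. CARD('a) = s ^ 2 \<and> (\<forall>x\<in>V. \<forall>y\<in>V. h y x = (h x y) ^ s))"
| "is_form_on scale V (Quadratic Q) \<longleftrightarrow>
     (\<forall>a. \<forall>x\<in>V. Q (scale a x) = a ^ 2 * Q x) \<and>
     bilinear_form_on scale V (sesquilinear_part (Quadratic Q))"

definition perp :: "'b set \<Rightarrow> ('a::field, 'b::ab_group_add) form \<Rightarrow> 'b set \<Rightarrow> 'b set"
  where "perp V f S = {x \<in> V. \<forall>y\<in>S. sesquilinear_part f x y = 0}"

text \<open>
  A quadratic form is non-singular if its radical contains no non-zero singular vector. In even
  characteristic and odd dimension the associated bilinear form then still has a 1-dimensional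
  radical.
\<close>

fun nondegenerate_on :: "'b set \<Rightarrow> ('a::field, 'b::ab_group_add) form \<Rightarrow> bool" where
  "nondegenerate_on V (Alternating \<beta>) \<longleftrightarrow> perp V (Alternating \<beta>) V = {0}"
| "nondegenerate_on V (Hermitian h) \<longleftrightarrow> perp V (Hermitian h) V = {0}"
| "nondegenerate_on V (Quadratic Q) \<longleftrightarrow> {x \<in> perp V (Quadratic Q) V. Q x = 0} = {0}"

fun totally_isotropic :: "('a::field, 'b::ab_group_add) form \<Rightarrow> 'b set \<Rightarrow> bool" where
  "totally_isotropic (Alternating \<beta>) U \<longleftrightarrow> (\<forall>x\<in>U. \<forall>y\<in>U. \<beta> x y = 0)"
| "totally_isotropic (Hermitian h) U \<longleftrightarrow> (\<forall>x\<in>U. \<forall>y\<in>U. h x y = 0)"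
| "totally_isotropic (Quadratic Q) U \<longleftrightarrow> (\<forall>x\<in>U. Q x = 0)"

definition polar_subspaces ::
    "('a::field \<Rightarrow> 'b::ab_group_add \<Rightarrow> 'b) \<Rightarrow> 'b set \<Rightarrow> ('a, 'b) form \<Rightarrow> 'b set set"
  where "polar_subspaces scale V f =
    {U. module.subspace scale U \<and> U \<subseteq> V \<and> totally_isotropic f U}"

definition polar_rank ::
    "('a::field \<Rightarrow> 'b::ab_group_add \<Rightarrow> 'b) \<Rightarrow> 'b set \<Rightarrow> ('a, 'b) form \<Rightarrow> nat"
  where "polar_rank scale V f = Max (vector_space.dim scale ` polar_subspaces scale V f)"

datatype polar_type =
  Sp | U_plus | U_minus | Omega_plus | Omega | Omega_minus

fun type_param :: "polar_type \<Rightarrow> real" where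
  "type_param Sp = 0"
| "type_param U_plus = - 1/2"
| "type_param U_minus = 1/2"
| "type_param Omega_plus = - 1"
| "type_param Omega = 0"
| "type_param Omega_minus = 1"

fun type_dim :: "polar_type \<Rightarrow> nat \<Rightarrow> nat" where
  "type_dim Sp r = 2 * r"
| "type_dim U_plus r = 2 * r"
| "type_dim U_minus r = 2 * r + 1"
| "type_dim Omega_plus r = 2 * r"
| "type_dim Omega r = 2 * r + 1"
| "type_dim Omega_minus r = 2 * r + 2"

fun type_kind :: "('a, 'b) form \<Rightarrow> polar_type set" where
  "type_kind (Alternating \<beta>) = {Sp}"
| "type_kind (Hermitian h) = {U_plus, U_minus}"
| "type_kind (Quadratic Q) = {Omega_plus, Omega, Omega_minus}"

locale classical_polar_space = vector_space scale
  for scale :: "'a::{field,finite} \<Rightarrow> 'b::ab_group_add \<Rightarrow> 'b" +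
  fixes V :: "'b set" and f :: "('a, 'b) form" and r :: nat and ty :: polar_type
  assumes subspace_V: "subspace V"
    and finite_dimensional_V: "\<exists>B. finite B \<and> span B = V"
    and form_on_V: "is_form_on scale V f"
    and nondegenerate_V: "nondegenerate_on V f"
    and rank_V: "polar_rank scale V f = r"
    and kind_of_type: "ty \<in> type_kind f"
    and dim_of_type: "dim V = type_dim ty r"

definition hyperplane ::
    "('a::field \<Rightarrow> 'b::ab_group_add \<Rightarrow> 'b) \<Rightarrow> 'b set \<Rightarrow> 'b set \<Rightarrow> bool"
  where "hyperplane scale V H \<longleftrightarrow> module.subspace scale H \<and> H \<subseteq> V \<and>
    vector_space.dim scale H + 1 = vector_space.dim scale V"

definition degenerate_hyperplane ::
    "('a::field \<Rightarrow> 'b::ab_group_add \<Rightarrow> 'b) \<Rightarrow> 'b set \<Rightarrow> ('a, 'b) form \<Rightarrow> 'b set \<Rightarrow> bool"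
  where "degenerate_hyperplane scale V f H \<longleftrightarrow> hyperplane scale V H \<and>
    (\<exists>P \<in> polar_subspaces scale V f. vector_space.dim scale P = 1 \<and> H = perp V f P)"

definition restriction :: "'b set set \<Rightarrow> 'b set \<Rightarrow> 'b set set"
  where "restriction \<Q> H = {U \<in> \<Q>. U \<subseteq> H}"

text \<open>
  \<open>k\<close> may exceed the rank of \<open>\<Q>\<close>; then the only possible design is the empty one.
\<close>

definition design ::
    "('a::field \<Rightarrow> 'b::ab_group_add \<Rightarrow> 'b) \<Rightarrow> 'b set set \<Rightarrow> nat \<Rightarrow> nat \<Rightarrow> nat \<Rightarrow> 'b set set \<Rightarrow> bool"
  where "design scale \<Q> t k l D \<longleftrightarrow>
    D \<subseteq> {B \<in> \<Q>. vector_space.dim scale B = k} \<and>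
    (\<forall>T \<in> \<Q>. vector_space.dim scale T = t \<longrightarrow> card {B \<in> D. T \<subseteq> B} = l)"

definition residual :: "'b set set \<Rightarrow> 'b set \<Rightarrow> 'b set set"
  where "residual D H = {B \<in> D. B \<subseteq> H}"

definition q_number :: "nat \<Rightarrow> nat \<Rightarrow> real"
  where "q_number q m = (real q ^ m - 1) / (real q - 1)"

end

theory Submission
  imports Defs "HOL-Computational_Algebra.Polynomial"
begin

text \<open>
  Let \<open>z T\<close> be the number of singular vectors orthogonal to a totally singular subspace \<open>T\<close>. If
  \<open>x\<close> is singular, orthogonal to \<open>T\<close> and outside \<open>T\<close>, then the vectors of \<open>perp T\<close> not orthogonal
  to \<open>x\<close> fall into cosets of the line of \<open>x\<close>, each containing the same number of singular vectors
  (1, \<open>sqrt q\<close> or \<open>q\<close> for a quadratic, Hermitian or alternating form). This gives a recursion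
  from \<open>T\<close> to \<open>span (insert x T)\<close>. Hence \<open>z T\<close> depends on \<open>dim T\<close> only, and it is anchored at a
  totally singular \<open>T\<close> of maximal dimension, where \<open>z T = card T\<close>; no Witt theorem is needed.

  A pigeonhole argument in \<open>perp U\<close> modulo \<open>U\<close>, for \<open>U\<close> of maximal dimension, bounds the dimension
  of the space by the rank. So a nondegenerate hyperplane is again a classical polar space, and its
  parameter is the old one minus 1 if the rank stays, plus 1 if it drops.

  For \<open>dim T = t - 1\<close>, counting the pairs of a block containing \<open>T\<close> and a vector of that block
  outside \<open>T\<close>, once in \<open>V\<close> and once in \<open>H\<close>, gives two linear equations for the numbers of blocks
  through \<open>T\<close> inside and not inside \<open>H\<close>.
\<close>

section \<open>Counting in finite fields and finite vector spaces\<close>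

text \<open>The fibres partition \<open>A\<close>. At most \<open>m\<close> of them, each of size at
  most \<open>c\<close>, cover \<open>c * m\<close> elements only if there is no slack anywhere.
  This turns upper bounds from polynomial degrees into exact counts.\<close>

lemma card_fibre_eq:
  assumes "finite A" "finite B" "f ` A \<subseteq> B" "card A = c * m" "card B \<le> m" "b \<in> B"
    and fibre: "\<And>b. b \<in> B \<Longrightarrow> card {a \<in> A. f a = b} \<le> c"
  shows "card {a \<in> A. f a = b} = c"
proof (rule ccontr)
  assume "card {a \<in> A. f a = b} \<noteq> c"
  with fibre[OF \<open>b \<in> B\<close>] have less: "card {a \<in> A. f a = b} < c"
    by simp
  have "card A = (\<Sum>b\<in>B. card {a \<in> A. f a = b})"
    using assms(1-3) by (subst card_eq_sum, subst sum.group[symmetric, of A B f]) auto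
  also have "\<dots> < (\<Sum>b\<in>B. c)"
    using less fibre assms by (intro sum_strict_mono_ex1) auto
  also have "\<dots> \<le> c * m"
    using \<open>card B \<le> m\<close> by (simp add: mult.commute)
  finally show False
    using assms(4) by simp
qed

lemma card_nth_roots_le:
  fixes d :: "'a::field"
  assumes "0 < n"
  shows "card {x. x ^ n = d} \<le> n"
proof -
  have "monom 1 n - [:d:] \<noteq> 0"
    using assms by (metis coeff_diff coeff_monom coeff_pCons_0 degree_0 degree_pCons_0 degree_monom_eq
        diff_eq_eq add_0 leD le_zero_eq zero_neq_one)
  from card_poly_roots_bound[OF this] have "card {x. x ^ n = d} \<le> degree (monom 1 n - [:d:])"
    by (simp add: poly_monom)
  also have "\<dots> \<le> n"
    by (rule degree_diff_le) (auto simp: degree_monom_le)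
  finally show ?thesis .
qed

lemma card_power_fixed_points_le:
  assumes "2 \<le> n"
  shows "card {x::'a::field. x ^ n = x} \<le> n"
proof -
  have deg: "degree (monom (1::'a) n - monom 1 1) = n"
    using assms degree_add_eq_left[of "- monom 1 1" "monom (1::'a) n"] by (simp add: degree_monom_eq)
  with assms have "monom (1::'a) n - monom 1 1 \<noteq> 0"
    by auto
  from card_poly_roots_bound[OF this] show ?thesis
    using deg by (simp add: poly_monom)
qed

lemma card_field_ge_2: "2 \<le> CARD('a::{field,finite})"
proof -
  have "card {0::'a, 1} \<le> CARD('a)"
    by (rule card_mono) auto
  then show ?thesis
    by simp
qed

lemma sqrt_card_field_ge_2:
  assumes "CARD('a::{field,finite}) = s ^ 2"
  shows "2 \<le> s"
proof (rule ccontr)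
  assume "\<not> 2 \<le> s"
  then have "s = 0 \<or> s = 1"
    by auto
  then show False
    using assms card_field_ge_2[where 'a='a] by auto
qed

lemma not_subset_of_card_less:
  assumes "card A < card C" "finite A"
  obtains x where "x \<in> C" "x \<notin> A"
  using assms by (metis card_mono leD subsetI)

text \<open>Zero has one square root and every other square at most two, so more than half of the
  field elements are squares. The sets of values \<open>a * x ^ 2\<close> and
  \<open>c - b * y ^ 2\<close> are then too large to be disjoint.\<close>

lemma exists_diagonal_representation:
  fixes a b c :: "'a::{field,finite}"
  assumes "a \<noteq> 0" "b \<noteq> 0"
  shows "\<exists>x y. a * x ^ 2 + b * y ^ 2 = c"
proof -
  let ?sq = "range (\<lambda>x::'a. x ^ 2)"
  have "CARD('a) = (\<Sum>d\<in>?sq. card {x::'a. x ^ 2 = d})"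
    by (subst card_eq_sum, subst sum.group[symmetric, of UNIV ?sq "\<lambda>x. x ^ 2"]) auto
  also have "\<dots> = card {x::'a. x ^ 2 = 0} + (\<Sum>d\<in>?sq - {0}. card {x::'a. x ^ 2 = d})"
    by (rule sum.remove) (auto intro: range_eqI[of _ _ 0])
  also have "\<dots> \<le> 1 + (\<Sum>d\<in>?sq - {0}. 2)"
    by (intro add_mono sum_mono card_nth_roots_le) auto
  also have "\<dots> < 2 * card ?sq"
  proof -
    have "0 \<in> ?sq"
      by (auto intro: range_eqI[of _ _ 0])
    then have "card ?sq \<noteq> 0"
      by (metis card_0_eq empty_iff finite)
    moreover have "1 + (\<Sum>d\<in>?sq - {0}. 2) = 1 + 2 * (card ?sq - 1)"
      using \<open>0 \<in> ?sq\<close> by (simp add: card_Diff_singleton)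
    ultimately show ?thesis
      by linarith
  qed
  finally have less: "CARD('a) < 2 * card ?sq" .
  have "card ((\<lambda>d. a * d) ` ?sq) = card ?sq" "card ((\<lambda>d. c - b * d) ` ?sq) = card ?sq"
    using assms by (auto intro!: card_image inj_onI)
  moreover have "card ((\<lambda>d. a * d) ` ?sq \<union> (\<lambda>d. c - b * d) ` ?sq) \<le> CARD('a)"
    by (rule card_mono) auto
  ultimately have "(\<lambda>d. a * d) ` ?sq \<inter> (\<lambda>d. c - b * d) ` ?sq \<noteq> {}"
    using less by (metis (no_types, lifting) card_Un_disjoint finite leD mult_2)
  then obtain x y where "a * x ^ 2 = c - b * y ^ 2"
    by auto
  then show ?thesis
    by (metis diff_add_cancel)
qed

text \<open>If \<open>x ^ 2 = y ^ 2\<close>, then \<open>(x - y) ^ 2\<close> is a multiple of 2,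
  hence 0. So squaring is injective and, on a finite field, surjective.\<close>

lemma power2_surj_of_char_2:
  assumes "(2::'a::{field,finite}) = 0"
  shows "surj (\<lambda>x::'a. x ^ 2)"
proof -
  have "inj (\<lambda>x::'a. x ^ 2)"
  proof (rule injI)
    fix x y :: 'a
    assume "x ^ 2 = y ^ 2"
    then have "(x - y) ^ 2 = x ^ 2 + x ^ 2 - 2 * x * y"
      by (simp add: power2_diff)
    also have "\<dots> = 2 * (x ^ 2 - x * y)"
      by (simp add: algebra_simps)
    finally show "x = y"
      using assms by simp
  qed
  then show ?thesis
    by (simp add: finite_UNIV_inj_surj)
qed

section \<open>Sizes and dimensions of subspaces over a finite field\<close>

context vector_space
begin

lemma span_insert_span: "span (insert x (span T)) = span (insert x T)"
  unfolding span_insert by (simp only: span_span)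

lemma span_insert_subspace:
  assumes "subspace T"
  shows "span (insert x T) = (\<lambda>(u, a). u + a *s x) ` (T \<times> UNIV)"
proof -
  have [simp]: "span T = T"
    using assms by simp
  show ?thesis
  proof (rule set_eqI)
    fix y
    show "y \<in> span (insert x T) \<longleftrightarrow> y \<in> (\<lambda>(u, a). u + a *s x) ` (T \<times> UNIV)"
      unfolding span_insert by (auto simp: image_iff) (metis diff_add_cancel, metis add_diff_cancel_right')
  qed
qed

lemma card_span_insert:
  assumes "subspace T" "x \<notin> T"
  shows "card (span (insert x T)) = CARD('a) * card T"
proof -
  have "inj_on (\<lambda>(u, a). u + a *s x) (T \<times> UNIV)"
  proof (rule inj_onI, clarify)
    fix u a v b
    assume uv: "u \<in> T" "v \<in> T" and eq: "u + a *s x = v + b *s x"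
    then have diff: "(a - b) *s x = v - u"
      by (simp add: algebra_simps)
    have "a = b"
    proof (rule ccontr)
      assume "a \<noteq> b"
      then have "x = inverse (a - b) *s ((a - b) *s x)"
        by simp
      then have "x \<in> T"
        using diff uv \<open>subspace T\<close> by (metis subspace_diff subspace_scale)
      with \<open>x \<notin> T\<close> show False ..
    qed
    with eq show "u = v \<and> a = b"
      by simp
  qed
  then show ?thesis
    using assms by (simp add: span_insert_subspace card_image card_cartesian_product mult.commute)
qed

end

locale finite_field_vector_space = vector_space scale
  for scale :: "'a::{field,finite} \<Rightarrow> 'b::ab_group_add \<Rightarrow> 'b"  (infixr \<open>*s\<close> 75)
begin

lemma finite_span:
  assumes "finite B"
  shows "finite (span B)"
  using assms
proof (induction B)
  case (insert x B)
  have "span (insert x B) = (\<lambda>(u, a). u + a *s x) ` (span B \<times> UNIV)"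
    using span_insert_subspace[of "span B" x] by (simp add: span_insert_span)
  with insert show ?case
    by simp
qed simp

lemma card_span_independent:
  assumes "finite B" "independent B"
  shows "card (span B) = CARD('a) ^ card B"
  using assms
proof (induction B)
  case (insert x B)
  then have "x \<notin> span B" "independent B"
    by (auto simp: independent_insert)
  with insert show ?case
    using card_span_insert[of "span B" x] by (simp add: span_insert_span)
qed simp

lemma finite_basis:
  assumes "subspace W" "finite W"
  obtains B where "finite B" "independent B" "span B = W" "card B = dim W"
proof -
  obtain B where "B \<subseteq> W" "independent B" "W \<subseteq> span B" "card B = dim W"
    using basis_exists by blast
  then show thesis
    using assms by (intro that[of B]) (auto intro: finite_subset dest: span_minimal)
qed

lemma card_subspace:
  assumes "subspace W" "finite W"
  shows "card W = CARD('a) ^ dim W"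
  using assms by (metis card_span_independent finite_basis)

lemma dim_eq_iff_card:
  assumes "subspace W" "finite W"
  shows "dim W = n \<longleftrightarrow> card W = CARD('a) ^ n"
  using card_subspace[OF assms] card_field_ge_2[where 'a='a] by simp

lemma dim_span_insert:
  assumes "subspace T" "finite T" "x \<notin> T"
  shows "dim (span (insert x T)) = dim T + 1"
proof (subst dim_eq_iff_card)
  show "finite (span (insert x T))"
    using assms span_insert_subspace[of T x] by simp
  show "card (span (insert x T)) = CARD('a) ^ (dim T + 1)"
    using assms by (simp add: card_span_insert card_subspace)
qed simp

lemma subspace_of_dim_exists:
  assumes "subspace W" "finite W" "n \<le> dim W"
  obtains U where "subspace U" "U \<subseteq> W" "dim U = n"
proof -
  obtain B where B: "finite B" "independent B" "span B = W" "card B = dim W"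
    using finite_basis assms by metis
  then obtain C where C: "C \<subseteq> B" "card C = n"
    using assms(3) by (metis obtain_subset_with_card_n)
  show thesis
  proof
    show "span C \<subseteq> W"
      using C B span_mono by blast
    show "dim (span C) = n"
      using C B independent_mono dim_span_eq_card_independent by blast
  qed simp
qed

text \<open>The line of \<open>w\<close> complements \<open>K\<close> in \<open>W\<close>. The last
  hypothesis is phrased through single vectors because that is how kernels and hyperplane sections
  supply it.\<close>

lemma card_eq_of_complement:
  assumes "subspace W" "subspace K" "K \<subseteq> W" "w \<in> W" "w \<notin> K"
    and "\<And>v. v \<in> W \<Longrightarrow> \<exists>a. v - a *s w \<in> K"
  shows "card W = CARD('a) * card K"
proof -
  have "span (insert w K) = W"
    using assms by (intro antisym span_minimal) (auto simp: span_insert span_eq_iff[THEN iffD2])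
  then show ?thesis
    using card_span_insert assms by metis
qed

lemma linear_form_on_subset: "linear_form_on scale V g \<Longrightarrow> W \<subseteq> V \<Longrightarrow> linear_form_on scale W g"
  by (simp add: linear_form_on_def subset_iff)

lemma bilinear_form_on_subset:
  assumes "bilinear_form_on scale V \<beta>" "W \<subseteq> V"
  shows "bilinear_form_on scale W \<beta>"
  using assms linear_form_on_subset unfolding bilinear_form_on_def by (meson subsetD)

text \<open>Every condition is quantified over \<open>V\<close>, and the Hermitian exponent
  \<open>s\<close> depends on the field alone, so the same \<open>f\<close> is a form on a
  hyperplane.\<close>

lemma is_form_on_subset:
  assumes form: "is_form_on scale V g" and sub: "W \<subseteq> V"
  shows "is_form_on scale W g"
proof (cases g)
  case (Alternating \<beta>)
  then show ?thesis
    using form sub bilinear_form_on_subset[OF _ sub] by (simp add: subset_iff)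
next
  case (Hermitian h)
  obtain s where "CARD('a) = s ^ 2" "\<forall>x\<in>V. \<forall>y\<in>V. h y x = (h x y) ^ s"
    using form unfolding Hermitian is_form_on.simps by (elim conjE exE)
  then have "\<exists>s. CARD('a) = s ^ 2 \<and> (\<forall>x\<in>W. \<forall>y\<in>W. h y x = (h x y) ^ s)"
    using sub by (intro exI[of _ s] conjI ballI) (blast dest: subsetD)+
  moreover have "\<forall>y\<in>W. linear_form_on scale W (\<lambda>x. h x y)"
    using form sub linear_form_on_subset[OF _ sub] unfolding Hermitian is_form_on.simps by blast
  ultimately show ?thesis
    unfolding Hermitian is_form_on.simps by (rule conjI[rotated])
next
  case (Quadratic Q)
  then show ?thesis
    using form sub bilinear_form_on_subset[OF _ sub]
    unfolding Quadratic is_form_on.simps by (meson subsetD)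
qed

lemma linear_form_on_0:
  assumes "linear_form_on scale W g" "subspace W"
  shows "g 0 = 0"
  using assms subspace_0[of W] unfolding linear_form_on_def
  by (metis mult_zero_left scale_zero_left)

lemma subspace_kernel_on:
  assumes "linear_form_on scale W g" "subspace W"
  shows "subspace {x \<in> W. g x = 0}"
  using assms linear_form_on_0[OF assms]
  by (intro subspaceI) (auto simp: linear_form_on_def subspace_0 subspace_add subspace_scale)

lemma card_kernel_on:
  assumes g: "linear_form_on scale W g" and W: "subspace W" and w: "w \<in> W" "g w \<noteq> 0"
  shows "card W = CARD('a) * card {x \<in> W. g x = 0}"
proof (rule card_eq_of_complement[OF W subspace_kernel_on[OF g W]])
  fix v
  assume v: "v \<in> W"
  let ?a = "g v / g w"
  have "g v = g ((v - ?a *s w) + ?a *s w)"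
    by simp
  also have "\<dots> = g (v - ?a *s w) + ?a * g w"
    using g v w W unfolding linear_form_on_def by (metis subspace_diff subspace_scale)
  finally show "\<exists>a. v - a *s w \<in> {x \<in> W. g x = 0}"
    using w v W by (intro exI[of _ ?a]) (auto simp: subspace_diff subspace_scale)
qed (use w in auto)

lemma card_kernel_on_ge:
  assumes "linear_form_on scale W g" "subspace W"
  shows "card W \<le> CARD('a) * card {x \<in> W. g x = 0}"
proof (cases "\<exists>w\<in>W. g w \<noteq> 0")
  case True
  then show ?thesis
    using card_kernel_on assms by force
next
  case False
  then have "{x \<in> W. g x = 0} = W"
    by auto
  then show ?thesis
    by simp
qed

text \<open>Some \<open>w\<close> in \<open>W\<close> outside \<open>H\<close> spans
  \<open>V\<close> together with \<open>H\<close>; subtracting a multiple of \<open>w\<close> takes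
  a vector of \<open>W\<close> into \<open>H\<close> without leaving \<open>W\<close>.\<close>

lemma card_inter_hyperplane:
  assumes H: "hyperplane scale V H" and "subspace V" "finite V"
    and W: "subspace W" "W \<subseteq> V" "\<not> W \<subseteq> H"
  shows "card W = CARD('a) * card (W \<inter> H)"
proof -
  have H': "subspace H" "H \<subseteq> V" "dim V = dim H + 1"
    using H by (auto simp: hyperplane_def)
  obtain w where w: "w \<in> W" "w \<notin> H"
    using W by blast
  have "span (insert w H) = V"
  proof (rule card_subset_eq)
    show "span (insert w H) \<subseteq> V"
      using w W H' \<open>subspace V\<close> by (intro span_minimal) auto
    show "card (span (insert w H)) = card V"
      using H' w \<open>subspace V\<close> \<open>finite V\<close> finite_subset[OF H'(2)]
      by (simp add: card_span_insert card_subspace)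
  qed fact
  then have "\<exists>a. v - a *s w \<in> H" if "v \<in> W" for v
    using that W H' by (auto simp: span_insert span_eq_iff[THEN iffD2])
  then show ?thesis
    using w W H' by (intro card_eq_of_complement[where w = w])
      (auto simp: subspace_inter subspace_diff subspace_scale)
qed

end

section \<open>Spaces with a nondegenerate form\<close>

text \<open>The condition for the line of \<open>x\<close> to belong to the polar space. It is void
  for alternating forms, which lets the three kinds share one argument.\<close>

fun singular :: "('a::field, 'b::ab_group_add) form \<Rightarrow> 'b \<Rightarrow> bool" where
  "singular (Alternating \<beta>) x \<longleftrightarrow> True"
| "singular (Hermitian h) x \<longleftrightarrow> h x x = 0"
| "singular (Quadratic Q) x \<longleftrightarrow> Q x = 0"

text \<open>The number of singular vectors in a coset of a singular line whose vectors are not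
  orthogonal to that line, as \<open>card_singular_coset\<close> shows; real because of the square
  root.\<close>

fun coset_count :: "('a::{field,finite}, 'b) form \<Rightarrow> real" where
  "coset_count (Alternating \<beta>) = real CARD('a)"
| "coset_count (Hermitian h) = sqrt (real CARD('a))"
| "coset_count (Quadratic Q) = 1"

locale nondegenerate_form_space = finite_field_vector_space scale
  for scale :: "'a::{field,finite} \<Rightarrow> 'b::ab_group_add \<Rightarrow> 'b"  (infixr \<open>*s\<close> 75) +
  fixes V :: "'b set" and f :: "('a, 'b) form"
  assumes subspace_V: "subspace V"
    and finite_V: "finite V"
    and form_on_V: "is_form_on scale V f"
    and nondegenerate_V: "nondegenerate_on V f"
begin

section \<open>Orthogonality and singular vectors\<close>

abbreviation B :: "'b \<Rightarrow> 'b \<Rightarrow> 'a" where "B \<equiv> sesquilinear_part f"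

text \<open>Linearity in the first argument is what all three kinds have in common. Statements about
  the second argument are mostly obtained from it through \<open>B_eq_0_sym\<close>.\<close>

lemma linear_form_B: "y \<in> V \<Longrightarrow> linear_form_on scale V (\<lambda>x. B x y)"
  using form_on_V by (cases f) (auto simp: bilinear_form_on_def)

lemma B_add: "x \<in> V \<Longrightarrow> y \<in> V \<Longrightarrow> z \<in> V \<Longrightarrow> B (x + y) z = B x z + B y z"
  using linear_form_B[of z] by (simp add: linear_form_on_def)

lemma B_scale: "x \<in> V \<Longrightarrow> z \<in> V \<Longrightarrow> B (a *s x) z = a * B x z"
  using linear_form_B[of z] by (simp add: linear_form_on_def)

lemma B_zero: "z \<in> V \<Longrightarrow> B 0 z = 0"
  using linear_form_on_0[OF linear_form_B subspace_V] .

lemma hermitian_exponent: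
  assumes "f = Hermitian h"
  shows "\<exists>s. CARD('a) = s ^ 2 \<and> 2 \<le> s \<and> (\<forall>x\<in>V. \<forall>y\<in>V. h y x = (h x y) ^ s)"
proof -
  obtain s where s: "CARD('a) = s ^ 2" and "\<forall>x\<in>V. \<forall>y\<in>V. h y x = (h x y) ^ s"
    using form_on_V unfolding assms is_form_on.simps by (elim conjE exE)
  with sqrt_card_field_ge_2[OF s] show ?thesis
    by (intro exI[of _ s] conjI)
qed

text \<open>For an alternating form, expand \<open>\<beta> (x + y) (x + y) = 0\<close>; for a
  Hermitian form, \<open>h y x\<close> is a power of \<open>h x y\<close> with positive exponent;
  the bilinear form of \<open>Q\<close> is symmetric.\<close>

lemma B_eq_0_sym:
  assumes "x \<in> V" "y \<in> V" "B x y = 0"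
  shows "B y x = 0"
proof (cases f)
  case (Alternating \<beta>)
  have alt: "\<beta> z z = 0" if "z \<in> V" for z
    using form_on_V that by (simp add: Alternating)
  have V: "x + y \<in> V"
    using assms subspace_V by (simp add: subspace_add)
  have "linear_form_on scale V (\<beta> (x + y))"
    using form_on_V V by (simp add: Alternating bilinear_form_on_def)
  then have "\<beta> (x + y) (x + y) = \<beta> (x + y) x + \<beta> (x + y) y"
    using assms by (simp add: linear_form_on_def)
  also have "\<dots> = \<beta> y x"
    using B_add[of x y x] B_add[of x y y] assms alt by (simp add: Alternating)
  finally show ?thesis
    using alt V by (simp add: Alternating)
next
  case (Hermitian h)
  then obtain s where s: "2 \<le> s" "\<forall>x\<in>V. \<forall>y\<in>V. h y x = (h x y) ^ s"
    using hermitian_exponent by blast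
  have "h y x = 0 ^ s"
    using s(2)[rule_format, OF assms(1,2)] assms(3) by (simp only: Hermitian sesquilinear_part.simps)
  with s(1) show ?thesis
    by (simp add: Hermitian)
next
  case (Quadratic Q)
  with assms(3) show ?thesis
    by (simp add: add.commute algebra_simps)
qed

lemma B_self:
  assumes "x \<in> V" "singular f x"
  shows "B x x = 0"
proof (cases f)
  case (Quadratic Q)
  have "Q (x + x) = Q ((1 + 1) *s x)"
    unfolding scale_left_distrib by simp
  also have "\<dots> = (1 + 1) ^ 2 * Q x"
    using form_on_V assms by (simp add: Quadratic)
  finally show ?thesis
    using assms by (simp add: Quadratic)
qed (use assms form_on_V in auto)

lemma singular_scale:
  assumes "x \<in> V" "singular f x"
  shows "singular f (a *s x)"
proof (cases f)
  case (Hermitian h)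
  have "B (a *s x) x = 0"
    using assms B_self[OF assms] B_scale[of x x a] by simp
  then have "B x (a *s x) = 0"
    using assms B_eq_0_sym subspace_scale[OF subspace_V] by blast
  then show ?thesis
    using assms B_scale[of x "a *s x" a] subspace_scale[OF subspace_V] by (simp add: Hermitian)
qed (use assms form_on_V in auto)

lemma singular_add:
  assumes "x \<in> V" "y \<in> V" "singular f x" "singular f y" "B x y = 0"
  shows "singular f (x + y)"
proof (cases f)
  case (Hermitian h)
  have V: "x + y \<in> V"
    using assms subspace_V by (simp add: subspace_add)
  have "B (x + y) x = 0" "B (x + y) y = 0"
    using assms B_add[of x y x] B_add[of x y y] B_eq_0_sym[of x y] B_self by auto
  then have "B x (x + y) = 0" "B y (x + y) = 0"
    using assms V B_eq_0_sym by blast+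
  then show ?thesis
    using assms V B_add[of x y "x + y"] by (simp add: Hermitian)
next
  case (Quadratic Q)
  with assms show ?thesis
    by simp
qed simp

text \<open>Gives the three nondegeneracy conditions one shape. Singularity matters for a quadratic
  form in characteristic 2, whose bilinear form may have a nonzero radical.\<close>

lemma singular_radical_eq_0:
  assumes "x \<in> V" "singular f x" "\<And>y. y \<in> V \<Longrightarrow> B y x = 0"
  shows "x = 0"
proof -
  have "\<forall>y\<in>V. B x y = 0"
    using assms B_eq_0_sym by blast
  then show ?thesis
    using assms nondegenerate_V by (cases f) (auto simp: perp_def)
qed

text \<open>Along the coset a quadratic form is affine in \<open>a\<close> with slope
  \<open>B y x\<close>, so it has one zero. A Hermitian form becomes a polynomial of degree
  \<open>s\<close> in \<open>a\<close>, and \<open>card_fibre_eq\<close> forces the count.\<close>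

lemma card_singular_coset:
  assumes xy: "x \<in> V" "y \<in> V" and x: "singular f x" and ne: "B y x \<noteq> 0"
  shows "real (card {a. singular f (y + a *s x)}) = coset_count f"
proof (cases f)
  case (Alternating \<beta>)
  then show ?thesis
    by simp
next
  case (Quadratic Q)
  have "Q (y + a *s x) = Q y + a * B y x" for a
  proof -
    have ax: "a *s x \<in> V"
      using xy subspace_V by (simp add: subspace_scale)
    have "B y (a *s x) = a * B y x"
      using xy form_on_V unfolding Quadratic
      by (auto simp: bilinear_form_on_def linear_form_on_def simp del: sesquilinear_part.simps)
    moreover have "Q (a *s x) = 0"
      using singular_scale[OF xy(1) x] by (simp add: Quadratic)
    ultimately show ?thesis
      by (simp add: Quadratic algebra_simps)
  qed
  moreover have "d + a * c = 0 \<longleftrightarrow> a = - d / c" if "c \<noteq> 0" for a c d :: 'a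
    by (simp only: nonzero_eq_divide_eq[OF that] add_eq_0_iff)
  ultimately have "{a. singular f (y + a *s x)} = {- Q y / B y x}"
    using ne by (simp add: Quadratic del: sesquilinear_part.simps)
  then show ?thesis
    by (simp add: Quadratic)
next
  case (Hermitian h)
  obtain s where s: "CARD('a) = s ^ 2" "2 \<le> s"
    and hs: "\<forall>x\<in>V. \<forall>y\<in>V. h y x = (h x y) ^ s"
    using hermitian_exponent[OF Hermitian] by blast
  have h: "h y x = (h x y) ^ s" if "x \<in> V" "y \<in> V" for x y
    using hs that by blast
  define g where "g a = h (y + a *s x) (y + a *s x)" for a
  define c where "c = h x y"
  have c: "c \<noteq> 0"
    using B_eq_0_sym[OF xy] ne by (auto simp: c_def Hermitian)
  \<comment> \<open>Expansion in the second argument is replaced by the power \<open>s\<close> of a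
    value linear in \<open>a\<close>; \<open>h x x = 0\<close> removes the product of
    \<open>a\<close> and its conjugate. The power stays unexpanded, so the degree in
    \<open>a\<close> is visible.\<close>
  have g: "g a = (h y y + a * c) ^ s + a * c" for a
  proof -
    have ax: "a *s x \<in> V" "y + a *s x \<in> V"
      using xy subspace_V by (simp_all add: subspace_scale subspace_add)
    have lin: "h (y + a *s x) z = h y z + a * h x z" if "z \<in> V" for z
      using that xy ax B_add[of y "a *s x" z] B_scale[of x z a] by (simp add: Hermitian)
    have "g a = h y (y + a *s x) + a * h x (y + a *s x)"
      unfolding g_def using ax by (simp add: lin)
    also have "h y (y + a *s x) = (h (y + a *s x) y) ^ s"
      by (rule h) (use ax xy in auto)
    also have "h x (y + a *s x) = (h (y + a *s x) x) ^ s"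
      by (rule h) (use ax xy in auto)
    also have "h (y + a *s x) y = h y y + a * c"
      using lin xy by (simp add: c_def)
    also have "h (y + a *s x) x = h y x"
      using lin xy x by (simp add: Hermitian)
    also have "h y x ^ s = h x y"
      using h[OF xy(2,1)] by simp
    finally show ?thesis
      by (simp add: c_def)
  qed
  \<comment> \<open>\<open>g\<close> maps the \<open>s\<^sup>2\<close> scalars into the at most \<open>s\<close> fixed points of \<open>d \<mapsto> d ^ s\<close>, and its fibres
    have at most \<open>s\<close> elements, so all fibres have exactly \<open>s\<close>; additivity of that map is not needed.\<close>
  have "card {a \<in> UNIV. g a = 0} = s"
  proof (rule card_fibre_eq)
    show "g ` UNIV \<subseteq> {d. d ^ s = d}"
      using h[symmetric] xy subspace_V by (auto simp: g_def subspace_add subspace_scale)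
    show "CARD('a) = s * s"
      using s by (simp add: power2_eq_square)
    show "card {d::'a. d ^ s = d} \<le> s"
      using s by (intro card_power_fixed_points_le)
    show "0 \<in> {d::'a. d ^ s = d}"
      using s by simp
    fix d
    let ?p = "[:h y y, c:] ^ s + [:- d, c:]"
    have "degree ([:h y y, c:] ^ s) = s"
      using c by (simp add: degree_power_eq)
    then have deg: "degree ?p = s"
      using s c by (subst degree_add_eq_left) auto
    then have "?p \<noteq> 0"
      using s by (metis degree_0 not_numeral_le_zero)
    moreover have "poly ?p a = g a - d" for a
      unfolding g by simp
    then have "{a \<in> UNIV. g a = d} = {a. poly ?p a = 0}"
      by (simp only: right_minus_eq UNIV_I simp_thms)
    ultimately show "card {a \<in> UNIV. g a = d} \<le> s"
      using card_poly_roots_bound[of ?p] deg by metis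
  qed auto
  then have "card {a. singular f (y + a *s x)} = s"
    by (simp add: Hermitian g_def)
  then show ?thesis
    using s by (simp add: Hermitian real_sqrt_abs)
qed

text \<open>For a quadratic form, isotropy follows from singularity because \<open>x + y\<close>
  stays in \<open>U\<close>; for a Hermitian form, singularity is the case \<open>y = x\<close> of
  isotropy.\<close>

lemma polar_subspaces_iff:
  "U \<in> polar_subspaces scale V f \<longleftrightarrow>
    subspace U \<and> U \<subseteq> V \<and> (\<forall>x\<in>U. singular f x) \<and> (\<forall>x\<in>U. \<forall>y\<in>U. B x y = 0)"
proof (cases f)
  case (Quadratic Q)
  have "B x y = 0" if "subspace U" "\<forall>x\<in>U. Q x = 0" "x \<in> U" "y \<in> U" for x y
    using that subspace_add[of U x y] by (simp add: Quadratic)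
  then show ?thesis
    by (auto simp: polar_subspaces_def Quadratic simp del: sesquilinear_part.simps)
qed (auto simp: polar_subspaces_def)

lemma polar_subspaceD:
  assumes "U \<in> polar_subspaces scale V f"
  shows "subspace U" "U \<subseteq> V" "finite U" "\<And>x. x \<in> U \<Longrightarrow> singular f x"
    "\<And>x y. x \<in> U \<Longrightarrow> y \<in> U \<Longrightarrow> B x y = 0"
  using assms finite_subset[OF _ finite_V] by (auto simp: polar_subspaces_iff)

lemma polar_subspace_subset:
  "U \<in> polar_subspaces scale V f \<Longrightarrow> subspace W \<Longrightarrow> W \<subseteq> U \<Longrightarrow> W \<in> polar_subspaces scale V f"
  by (auto simp: polar_subspaces_iff subset_iff)

lemma zero_polar_subspace: "{0} \<in> polar_subspaces scale V f"
proof -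
  have "singular f 0"
  proof (cases f)
    case (Quadratic Q)
    then have "Q (0 *s 0) = 0 ^ 2 * Q 0"
      using form_on_V subspace_0[OF subspace_V] by (simp del: scale_zero_left scale_zero_right)
    then show ?thesis
      by (simp add: Quadratic)
  qed (use subspace_0[OF subspace_V] B_zero[of 0] in auto)
  then show ?thesis
    using subspace_0[OF subspace_V] B_zero[of 0] by (simp add: polar_subspaces_iff)
qed

section \<open>Perps and their sizes\<close>

lemma subspace_perp:
  assumes "T \<subseteq> V"
  shows "subspace (perp V f T)"
proof (rule subspaceI)
  show "0 \<in> perp V f T"
    using assms B_zero subspace_0[OF subspace_V] by (auto simp: perp_def)
next
  fix x y
  assume "x \<in> perp V f T" "y \<in> perp V f T"
  then show "x + y \<in> perp V f T"
    using assms B_add subspace_add[OF subspace_V] by (auto simp: perp_def subset_iff)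
next
  fix a x
  assume "x \<in> perp V f T"
  then show "a *s x \<in> perp V f T"
    using assms B_scale subspace_scale[OF subspace_V] by (auto simp: perp_def subset_iff)
qed

lemma perp_subset: "perp V f T \<subseteq> V"
  by (auto simp: perp_def)

lemma finite_perp: "finite (perp V f T)"
  using finite_subset[OF perp_subset finite_V] .

text \<open>The vectors \<open>z\<close> with \<open>B z y = 0\<close> form a subspace, so
  orthogonality to \<open>y\<close> passes from \<open>insert x T\<close> to its span.\<close>

lemma perp_span_insert:
  assumes "subspace T" "T \<subseteq> V" "x \<in> V"
  shows "perp V f (span (insert x T)) = {y \<in> perp V f T. B y x = 0}"
proof (intro antisym subsetI)
  fix y
  assume "y \<in> perp V f (span (insert x T))"
  then show "y \<in> {y \<in> perp V f T. B y x = 0}"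
    using span_superset[of "insert x T"] by (auto simp: perp_def)
next
  fix y
  assume y: "y \<in> {y \<in> perp V f T. B y x = 0}"
  then have "y \<in> V"
    by (simp add: perp_def)
  have "span (insert x T) \<subseteq> {z \<in> V. B z y = 0}"
    using y assms B_eq_0_sym subspace_kernel_on[OF linear_form_B subspace_V]
    by (intro span_minimal) (auto simp: perp_def)
  then show "y \<in> perp V f (span (insert x T))"
    using \<open>y \<in> V\<close> B_eq_0_sym by (auto simp: perp_def)
qed

text \<open>Double counting of the orthogonal pairs in \<open>V \<times> T\<close>.\<close>

lemma card_perp_mult:
  assumes T: "subspace T" "T \<subseteq> V" and nd: "\<And>x. x \<in> T \<Longrightarrow> x \<noteq> 0 \<Longrightarrow> \<exists>v\<in>V. B v x \<noteq> 0"
  shows "card (perp V f T) * card T = card V"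
proof -
  let ?q = "CARD('a)"
  let ?P = "perp V f T"
  have fin: "finite T"
    using T finite_V finite_subset by blast
  have pos: "card T > 0"
    using fin subspace_0[OF T(1)] by (auto simp: card_gt_0_iff)
  \<comment> \<open>The factor \<open>?q\<close> clears denominators: a nonzero \<open>t\<close> is
    orthogonal to a fraction \<open>1 / ?q\<close> of \<open>V\<close>, and \<open>t = 0\<close> to
    all of it.\<close>
  have "(\<Sum>t\<in>T. ?q * card {v \<in> V. B v t = 0}) = ?q * card V + (\<Sum>t\<in>T - {0}. ?q * card {v \<in> V. B v t = 0})"
  proof (subst sum.remove[OF fin subspace_0[OF T(1)]])
    have "{v \<in> V. B v 0 = 0} = V"
      using B_zero B_eq_0_sym subspace_0[OF subspace_V] by blast
    then show "?q * card {v \<in> V. B v 0 = 0} + (\<Sum>t\<in>T - {0}. ?q * card {v \<in> V. B v t = 0}) =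
        ?q * card V + (\<Sum>t\<in>T - {0}. ?q * card {v \<in> V. B v t = 0})"
      by simp
  qed
  also have "(\<Sum>t\<in>T - {0}. ?q * card {v \<in> V. B v t = 0}) = (\<Sum>t\<in>T - {0}. card V)"
  proof (rule sum.cong)
    fix t
    assume t: "t \<in> T - {0}"
    then obtain v where "v \<in> V" "B v t \<noteq> 0"
      using nd by blast
    then show "?q * card {v \<in> V. B v t = 0} = card V"
      using t T by (intro card_kernel_on[OF linear_form_B subspace_V, symmetric]) auto
  qed simp
  also have "\<dots> = (card T - 1) * card V"
    using subspace_0[OF T(1)] by (simp add: card_Diff_singleton)
  finally have 1: "(\<Sum>t\<in>T. ?q * card {v \<in> V. B v t = 0}) = ?q * card V + (card T - 1) * card V" .

  have "(\<Sum>v\<in>V. ?q * card {t \<in> T. B v t = 0}) =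
      (\<Sum>v\<in>?P. ?q * card {t \<in> T. B v t = 0}) + (\<Sum>v\<in>V - ?P. ?q * card {t \<in> T. B v t = 0})"
    using finite_V perp_subset[of T] by (simp add: sum.subset_diff)
  also have "(\<Sum>v\<in>?P. ?q * card {t \<in> T. B v t = 0}) = (\<Sum>v\<in>?P. ?q * card T)"
    by (rule sum.cong) (auto simp: perp_def intro!: arg_cong[of _ _ card])
  also have "\<dots> = ?q * (card ?P * card T)"
    by simp
  also have "(\<Sum>v\<in>V - ?P. ?q * card {t \<in> T. B v t = 0}) = (\<Sum>v\<in>V - ?P. card T)"
  proof (rule sum.cong)
    fix v
    assume v: "v \<in> V - ?P"
    then obtain w where "w \<in> T" "B v w \<noteq> 0"
      by (auto simp: perp_def)
    then have "B w v \<noteq> 0"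
      using v T B_eq_0_sym by blast
    then have "card T = ?q * card {t \<in> T. B t v = 0}"
      using v T \<open>w \<in> T\<close> linear_form_on_subset[OF linear_form_B]
      by (intro card_kernel_on[where g = "\<lambda>t. B t v"]) auto
    also have "{t \<in> T. B t v = 0} = {t \<in> T. B v t = 0}"
      using v T B_eq_0_sym by blast
    finally show "?q * card {t \<in> T. B v t = 0} = card T"
      by simp
  qed simp
  also have "\<dots> = (card V - card ?P) * card T"
    using finite_perp perp_subset by (simp add: card_Diff_subset)
  finally have 2: "(\<Sum>v\<in>V. ?q * card {t \<in> T. B v t = 0}) =
      ?q * (card ?P * card T) + (card V - card ?P) * card T" .

  have "(\<Sum>t\<in>T. card {v \<in> V. B v t = 0}) = (\<Sum>v\<in>V. card {t \<in> T. B v t = 0})"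
    by (rule sum_multicount_gen) (use fin finite_V in auto)
  then have eq: "?q * card V + (card T - 1) * card V =
      ?q * (card ?P * card T) + (card V - card ?P) * card T"
    using 1 2 by (simp flip: sum_distrib_left)
  \<comment> \<open>The truncated subtractions are moved to the integers, where the common factor
    \<open>?q - 1\<close> cancels.\<close>
  have "card ?P \<le> card V"
    using finite_V perp_subset by (rule card_mono)
  then have "int (card T - 1) = int (card T) - 1" "int (card V - card ?P) = int (card V) - int (card ?P)"
    using pos by (simp_all add: of_nat_diff)
  then have "int ?q * int (card V) + (int (card T) - 1) * int (card V) =
      int ?q * (int (card ?P) * int (card T)) + (int (card V) - int (card ?P)) * int (card T)"
    using eq by (metis of_nat_add of_nat_mult)
  then have "(int ?q - 1) * (int (card ?P) * int (card T)) = (int ?q - 1) * int (card V)"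
    by algebra
  then have "int (card ?P * card T) = int (card V)"
    using card_field_ge_2[where 'a='a] by simp
  then show ?thesis
    by (simp only: of_nat_eq_iff)
qed

lemma card_perp:
  assumes "T \<in> polar_subspaces scale V f"
  shows "card (perp V f T) * card T = card V"
  using assms polar_subspaceD singular_radical_eq_0 by (intro card_perp_mult) blast+

lemma polar_subspace_subset_perp: "T \<in> polar_subspaces scale V f \<Longrightarrow> T \<subseteq> perp V f T"
  by (auto simp: perp_def polar_subspaces_iff)

text \<open>A vector \<open>u + a *s x\<close> is a sum of orthogonal singular vectors, hence
  singular. Perps are subspaces, so isotropy can be checked on the generators.\<close>

lemma span_insert_polar:
  assumes T: "T \<in> polar_subspaces scale V f" and x: "x \<in> perp V f T" "singular f x"
  shows "span (insert x T) \<in> polar_subspaces scale V f"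
proof -
  note TD = polar_subspaceD[OF T]
  have xV: "x \<in> V" and xT: "\<And>y. y \<in> T \<Longrightarrow> B x y = 0 \<and> B y x = 0"
    using x TD(2) B_eq_0_sym by (auto simp: perp_def)
  have sub: "span (insert x T) \<subseteq> V"
    using xV TD subspace_V by (intro span_minimal) auto
  have sing: "singular f y \<and> B y x = 0" if y_in: "y \<in> span (insert x T)" for y
  proof -
    obtain u a where y: "u \<in> T" "y = u + a *s x"
      using y_in unfolding span_insert_subspace[OF TD(1)] by auto
    have u: "u \<in> V" "a *s x \<in> V" "singular f u" "singular f (a *s x)"
      using y TD xV x singular_scale subspace_scale[OF subspace_V] by auto
    have "B (a *s x) u = 0" "B (a *s x) x = 0"
      using B_scale xV u xT[OF y(1)] B_self[OF xV x(2)] by auto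
    moreover have "B u (a *s x) = 0"
      using u B_eq_0_sym \<open>B (a *s x) u = 0\<close> by blast
    ultimately show ?thesis
      using y u xT[OF y(1)] B_add[OF u(1,2) xV] singular_add by simp
  qed
  have "span (insert x T) \<subseteq> perp V f (span (insert x T))"
  proof -
    have "insert x T \<subseteq> perp V f (span (insert x T))"
      unfolding perp_span_insert[OF TD(1,2) xV]
      using TD(2,5) xT B_self[OF xV x(2)] x(1) by (auto simp: perp_def)
    then show ?thesis
      by (rule span_minimal[OF _ subspace_perp[OF sub]])
  qed
  then show ?thesis
    using sub sing by (auto simp: polar_subspaces_iff perp_def)
qed

section \<open>The number of singular vectors orthogonal to a totally singular subspace\<close>

definition singular_count :: "'b set \<Rightarrow> nat"
  where "singular_count T = card {x \<in> perp V f T. singular f x}"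

text \<open>
  The vectors of \<open>perp V f T\<close> outside the perp of \<open>x\<close> fall into cosets of the line of \<open>x\<close>, each
  of which contains \<open>coset_count f\<close> singular vectors.
\<close>

lemma singular_count_span_insert:
  assumes T: "T \<in> polar_subspaces scale V f" and x: "x \<in> perp V f T" "singular f x"
  shows "real CARD('a) * (real (singular_count T) - real (singular_count (span (insert x T)))) =
    coset_count f * (real (card (perp V f T)) - real (card (perp V f (span (insert x T)))))"
proof -
  note TD = polar_subspaceD[OF T]
  have xV: "x \<in> V"
    using x by (simp add: perp_def)
  let ?W = "perp V f T"
  let ?W' = "perp V f (span (insert x T))"
  note W' = perp_span_insert[OF TD(1,2) xV]
  define A where "A = ?W - ?W'"
  have finA: "finite A"
    using finite_perp by (simp add: A_def)
  have A: "y \<in> A \<longleftrightarrow> y \<in> ?W \<and> B y x \<noteq> 0" for y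
    by (auto simp: A_def W')
  have shift: "y + a *s x \<in> A \<longleftrightarrow> y \<in> A" for y a
  proof -
    have *: "y + a *s x \<in> A" if "y \<in> A" for y a
    proof -
      have "y \<in> V" "a *s x \<in> V"
        using that xV subspace_scale[OF subspace_V] by (auto simp: A perp_def)
      then have "B (y + a *s x) x = B y x"
        using B_add B_scale xV B_self[OF xV x(2)] by simp
      then show ?thesis
        using that x subspace_perp[OF TD(2)] by (simp add: A subspace_add subspace_scale)
    qed
    show ?thesis
      using *[of y a] *[of "y + a *s x" "- a"] by auto
  qed
  \<comment> \<open>Every translation by a multiple of \<open>x\<close> permutes \<open>A\<close>.
    Counting over all translations at once avoids choosing representatives of the cosets.\<close>
  have "card {y \<in> A. singular f (y + a *s x)} = card {y \<in> A. singular f y}" for a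
    by (rule bij_betw_same_card[of "\<lambda>y. y + a *s x"],
        rule bij_betw_byWitness[where f' = "\<lambda>y. y - a *s x"])
      (use shift[of _ a] shift[of _ "- a"] in \<open>auto simp: image_subset_iff\<close>)
  then have "real CARD('a) * real (card {y \<in> A. singular f y}) =
      real (\<Sum>a\<in>UNIV. card {y \<in> A. singular f (y + a *s x)})"
    by simp
  also have "(\<Sum>a\<in>UNIV. card {y \<in> A. singular f (y + a *s x)}) =
      (\<Sum>y\<in>A. card {a \<in> UNIV. singular f (y + a *s x)})"
    by (rule sum_multicount_gen) (use finA in auto)
  also have "real (\<Sum>y\<in>A. card {a \<in> UNIV. singular f (y + a *s x)}) = (\<Sum>y\<in>A. coset_count f)"
    unfolding of_nat_sum
    by (rule sum.cong) (use xV card_singular_coset[OF xV _ x(2)] in \<open>auto simp: A perp_def\<close>)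
  finally have "real CARD('a) * real (card {y \<in> A. singular f y}) = coset_count f * real (card A)"
    by (simp add: mult.commute)
  moreover have "real (card A) = real (card ?W) - real (card ?W')"
    unfolding A_def using finite_perp W'
    by (subst card_Diff_subset) (auto intro!: of_nat_diff card_mono)
  moreover have "real (card {y \<in> A. singular f y}) =
      real (singular_count T) - real (singular_count (span (insert x T)))"
  proof -
    have "{y \<in> A. singular f y} = {y \<in> ?W. singular f y} - {y \<in> ?W'. singular f y}"
      by (auto simp: A_def)
    then show ?thesis
      unfolding singular_count_def using finite_perp W'
      by (simp only:, subst card_Diff_subset) (auto intro!: of_nat_diff card_mono)
  qed
  ultimately show ?thesis
    by simp
qed

text \<open>The recursion is summed along a basis of \<open>T\<close>. By \<open>card_perp\<close>
  the perps have size \<open>card V / card T\<close>, so the sum telescopes.\<close>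

lemma singular_count_diff_zero:
  assumes "T \<in> polar_subspaces scale V f"
  shows "real (singular_count T) =
    real (singular_count {0}) + coset_count f * real (card V) / real CARD('a) * (1 / real (card T) - 1)"
proof -
  let ?q = "real CARD('a)"
  have q: "?q \<noteq> 0"
    by simp
  obtain C where C: "finite C" "independent C" "span C = T"
    using finite_basis polar_subspaceD[OF assms] by metis
  have "real (singular_count (span C)) = real (singular_count {0}) +
      coset_count f * real (card V) / ?q * (1 / real (card (span C)) - 1)"
    if "span C \<in> polar_subspaces scale V f"
    using C(1,2) that
  proof (induction C)
    case (insert x C)
    have x: "x \<notin> span C" "independent C"
      using insert by (auto simp: independent_insert)
    let ?T = "span C"
    let ?T' = "span (insert x C)"
    have T': "?T' = span (insert x ?T)"
      by (simp add: span_insert_span)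
    have T: "?T \<in> polar_subspaces scale V f"
      using insert.prems(2) by (rule polar_subspace_subset) (auto intro: span_mono[THEN subsetD])
    have xT: "x \<in> perp V f ?T" "singular f x"
      using polar_subspaceD[OF insert.prems(2)] span_base[of x "insert x C"]
        span_mono[of C "insert x C"] by (auto simp: perp_def subset_iff)
    have cardT': "real (card ?T') = ?q * real (card ?T)"
      unfolding T' using x by (simp add: card_span_insert)
    have pos: "real (card ?T) \<noteq> 0"
      using polar_subspaceD(3)[OF T] span_zero[of C] by (auto simp: card_eq_0_iff)
    have "real (card (perp V f ?T)) = real (card V) / real (card ?T)"
      "real (card (perp V f ?T')) = real (card V) / (?q * real (card ?T))"
      using card_perp[OF T] card_perp[OF insert.prems(2)] cardT' pos
      by (simp_all add: eq_divide_eq flip: of_nat_mult)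
    then have "?q * (real (singular_count ?T) - real (singular_count ?T')) =
      coset_count f * (real (card V) / real (card ?T) - real (card V) / (?q * real (card ?T)))"
      using singular_count_span_insert[OF T xT] by (simp add: T')
    then have "real (singular_count ?T') = real (singular_count ?T) - 
      coset_count f * (real (card V) / real (card ?T) - real (card V) / (?q * real (card ?T))) / ?q"
      using q by (simp add: field_simps)
    then show ?case
      using insert.IH[OF x(2) T] cardT' by (simp add: algebra_simps diff_divide_distrib add_divide_distrib)
  qed simp
  then show ?thesis
    using C assms by simp
qed

section \<open>The rank and the subspaces that attain it\<close>

abbreviation rank :: nat where "rank \<equiv> polar_rank scale V f"

lemma finite_polar_subspaces: "finite (polar_subspaces scale V f)"
  by (rule finite_subset[of _ "Pow V"]) (auto simp: finite_V polar_subspaces_def)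

lemma dim_le_rank: "U \<in> polar_subspaces scale V f \<Longrightarrow> dim U \<le> rank"
  unfolding polar_rank_def using finite_polar_subspaces by simp

lemma rank_attained:
  obtains U where "U \<in> polar_subspaces scale V f" "dim U = rank"
proof -
  have "rank \<in> dim ` polar_subspaces scale V f"
    unfolding polar_rank_def using finite_polar_subspaces zero_polar_subspace
    by (intro Max_in) auto
  then show thesis
    using that by auto
qed

text \<open>A singular \<open>x\<close> outside \<open>U\<close> would extend \<open>U\<close>. So
  the quotient of \<open>perp V f U\<close> by \<open>U\<close> has no nonzero singular vector,
  which the dimension bounds exploit.\<close>

lemma singular_perp_maximal:
  assumes U: "U \<in> polar_subspaces scale V f" "dim U = rank"
    and x: "x \<in> perp V f U" "singular f x"
  shows "x \<in> U"
proof (rule ccontr)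
  assume "x \<notin> U"
  then have "dim (span (insert x U)) = rank + 1"
    using U polar_subspaceD[OF U(1)] by (subst dim_span_insert) auto
  then show False
    using dim_le_rank[OF span_insert_polar[OF U(1) x]] by simp
qed

text \<open>At a maximal \<open>U\<close> the singular vectors of the perp are exactly those of
  \<open>U\<close>. Comparing both \<open>T\<close> and \<open>U\<close> with \<open>{0}\<close>
  eliminates the unknown \<open>singular_count {0}\<close>.\<close>

lemma singular_count_formula:
  assumes T: "T \<in> polar_subspaces scale V f"
  shows "real (singular_count T) = real CARD('a) ^ rank +
    coset_count f * real (card V) / real CARD('a) * (1 / real (card T) - 1 / real CARD('a) ^ rank)"
proof -
  obtain U where U: "U \<in> polar_subspaces scale V f" "dim U = rank"
    by (rule rank_attained)
  have cardU: "card U = CARD('a) ^ rank"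
    using U polar_subspaceD[OF U(1)] by (simp add: card_subspace)
  have "{x \<in> perp V f U. singular f x} = U"
    using U polar_subspaceD[OF U(1)] polar_subspace_subset_perp singular_perp_maximal by blast
  then have "singular_count U = CARD('a) ^ rank"
    by (simp add: singular_count_def cardU)
  moreover define K where "K = coset_count f * real (card V) / real CARD('a)"
  have "real (singular_count T) = real (singular_count {0}) + K * (1 / real (card T) - 1)"
    "real (singular_count U) = real (singular_count {0}) + K * (1 / real (card U) - 1)"
    unfolding K_def by (rule singular_count_diff_zero, fact)+
  ultimately show ?thesis
    unfolding K_def[symmetric] by (simp add: cardU right_diff_distrib)
qed

lemma two_rank_le_dim: "2 * rank \<le> dim V"
proof -
  obtain U where U: "U \<in> polar_subspaces scale V f" "dim U = rank"
    by (rule rank_attained)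
  have "card U \<le> card (perp V f U)"
    using polar_subspace_subset_perp[OF U(1)] finite_perp by (rule card_mono[rotated])
  then have "card U * card U \<le> card V"
    using card_perp[OF U(1)] by (metis mult_le_mono1)
  then have "CARD('a) ^ (2 * rank) \<le> CARD('a) ^ dim V"
    using U polar_subspaceD[OF U(1)] subspace_V finite_V
    by (simp add: card_subspace mult_2 power_add)
  then show ?thesis
    using card_field_ge_2[where 'a='a] by simp
qed

section \<open>Bounding the dimension from above by the rank\<close>

lemma card_perp_inter_le:
  assumes "subspace W" "W \<subseteq> V" "x \<in> V"
  shows "card W \<le> CARD('a) * card {y \<in> W. B y x = 0}"
  using assms linear_form_on_subset[OF linear_form_B] by (intro card_kernel_on_ge) auto

lemma subspace_perp_inter:
  assumes "subspace W" "W \<subseteq> V" "x \<in> V"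
  shows "subspace {y \<in> W. B y x = 0}"
  using assms linear_form_on_subset[OF linear_form_B] by (intro subspace_kernel_on) auto

lemma card_perp_maximal:
  assumes "U \<in> polar_subspaces scale V f" "dim U = rank" "dim V = 2 * rank + m"
  shows "card (perp V f U) = CARD('a) ^ m * card U"
proof -
  have U: "card U = CARD('a) ^ rank"
    using assms polar_subspaceD[OF assms(1)] by (simp add: card_subspace)
  have "card (perp V f U) * card U = (CARD('a) ^ m * card U) * card U"
    using card_perp[OF assms(1)] assms(3) subspace_V finite_V
    by (simp add: card_subspace U power_add mult_2)
  then show ?thesis
    by (simp add: U)
qed

text \<open>If the perp of a maximal \<open>U\<close> exceeded \<open>U\<close> by two dimensions,
  it would contain orthogonal nonsingular \<open>x\<close> and \<open>y\<close> outside
  \<open>U\<close>, and some \<open>x + a *s y\<close> would be singular, hence in \<open>U\<close>.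
  But it is not orthogonal to \<open>x\<close>.\<close>

lemma dim_le_hermitian:
  assumes "f = Hermitian h"
  shows "dim V \<le> 2 * rank + 1"
proof (rule ccontr)
  let ?q = "CARD('a)"
  assume "\<not> dim V \<le> 2 * rank + 1"
  then have "dim V = 2 * rank + ((dim V - 2 * rank - 2) + 2)"
    by simp
  then obtain m where m: "dim V = 2 * rank + (m + 2)"
    by blast
  obtain U where U: "U \<in> polar_subspaces scale V f" "dim U = rank"
    by (rule rank_attained)
  note UD = polar_subspaceD[OF U(1)]
  let ?W = "perp V f U"
  have q: "1 < ?q"
    using card_field_ge_2[where 'a='a] by simp
  have U0: "card U > 0"
    using UD(3) subspace_0[OF UD(1)] by (auto simp: card_gt_0_iff)
  have W: "subspace ?W" "?W \<subseteq> V" "finite ?W"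
    using subspace_perp[OF UD(2)] perp_subset finite_perp by auto
  have cardW: "?q * (?q * card U) \<le> card ?W"
    using card_perp_maximal[OF U m] q by (simp add: power_add power2_eq_square)
  have less: "card U < ?q * card U" "?q * card U < ?q * (?q * card U)"
    using q U0 by auto
  then have "card U < card ?W"
    using cardW by linarith
  then obtain x where x: "x \<in> ?W" "x \<notin> U"
    using not_subset_of_card_less UD(3) by blast
  have xV: "x \<in> V"
    using x W by blast
  have "?q * (?q * card U) \<le> ?q * card {y \<in> ?W. B y x = 0}"
    using cardW card_perp_inter_le[OF W(1,2) xV] by linarith
  then have "?q * card U \<le> card {y \<in> ?W. B y x = 0}"
    by simp
  then have "card U < card {y \<in> ?W. B y x = 0}"
    using less by linarith
  then obtain y where y: "y \<in> ?W" "B y x = 0" "y \<notin> U"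
    using not_subset_of_card_less UD(3) by blast
  have yV: "y \<in> V"
    using y W by blast
  have hx: "h x x \<noteq> 0" and hy: "h y y \<noteq> 0"
    using singular_perp_maximal[OF U] x y by (auto simp: assms)
  obtain s where s: "?q = s ^ 2" "2 \<le> s" and hs: "\<forall>x\<in>V. \<forall>y\<in>V. h y x = (h x y) ^ s"
    using hermitian_exponent[OF assms] by blast
  have h: "h y x = (h x y) ^ s" if "x \<in> V" "y \<in> V" for x y
    using hs that by blast
  have hyx: "h y x = 0" "h x y = 0"
    using y(2) B_eq_0_sym[OF yV xV] by (auto simp: assms)
  define g where "g a = h (x + a *s y) (x + a *s y)" for a
  have g: "g a = h x x + a ^ (s + 1) * h y y" for a
  proof -
    have ay: "a *s y \<in> V" "x + a *s y \<in> V"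
      using xV yV subspace_V by (simp_all add: subspace_scale subspace_add)
    have lin: "h (x + a *s y) z = h x z + a * h y z" if "z \<in> V" for z
      using that xV yV ay B_add[of x "a *s y" z] B_scale[of y z a] by (simp add: assms)
    have "g a = h x (x + a *s y) + a * h y (x + a *s y)"
      unfolding g_def using ay by (simp add: lin)
    also have "h x (x + a *s y) = (h (x + a *s y) x) ^ s"
      by (rule h) (use ay xV in auto)
    also have "h y (x + a *s y) = (h (x + a *s y) y) ^ s"
      by (rule h) (use ay yV in auto)
    also have "h (x + a *s y) x = h x x"
      using lin xV hyx by simp
    also have "h (x + a *s y) y = a * h y y"
      using lin yV hyx by simp
    also have "h x x ^ s = h x x"
      by (rule h[symmetric]) (use xV in auto)
    also have "(a * h y y) ^ s = a ^ s * h y y"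
      using h[OF yV yV, symmetric] by (simp add: power_mult_distrib)
    finally show ?thesis
      by simp
  qed
  \<comment> \<open>Pigeonhole: \<open>(s + 1) * (s - 1)\<close> nonzero scalars, at most \<open>s - 1\<close> values other than \<open>h x x\<close>, and
    fibres of size at most \<open>s + 1\<close>, so the value 0 is attained.\<close>
  have "card {a \<in> UNIV - {0}. g a = 0} = s + 1"
  proof (rule card_fibre_eq)
    show "g ` (UNIV - {0}) \<subseteq> {d. d ^ s = d} - {h x x}"
    proof safe
      fix a
      show "g a ^ s = g a"
        using h[symmetric] xV yV subspace_V by (auto simp: g_def subspace_add subspace_scale)
      assume "a \<noteq> 0" "g a = h x x"
      then show False
        using hy by (simp add: g)
    qed
    show "card (UNIV - {0::'a}) = (s + 1) * (s - 1)"
      using s by (simp add: card_Diff_singleton power2_eq_square algebra_simps)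
    have "card ({d. d ^ s = d} - {h x x}) = card {d::'a. d ^ s = d} - 1"
      using h[OF xV xV, symmetric] by (simp add: card_Diff_singleton)
    then show "card ({d. d ^ s = d} - {h x x}) \<le> s - 1"
      using card_power_fixed_points_le[OF s(2), where 'a = 'a] by simp
    show "0 \<in> {d. d ^ s = d} - {h x x}"
      using s hx by auto
    fix d
    have "{a \<in> UNIV - {0}. g a = d} \<subseteq> {a. a ^ (s + 1) = (d - h x x) / h y y}"
      using hy unfolding g by auto
    then have "card {a \<in> UNIV - {0}. g a = d} \<le> card {a. a ^ (s + 1) = (d - h x x) / h y y}"
      by (intro card_mono) auto
    also have "\<dots> \<le> s + 1"
      by (rule card_nth_roots_le) simp
    finally show "card {a \<in> UNIV - {0}. g a = d} \<le> s + 1" .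
  qed auto
  then have "{a \<in> UNIV - {0}. g a = 0} \<noteq> {}"
    by (metis card.empty add_is_0 one_neq_zero)
  then obtain a where a: "g a = 0"
    by blast
  have "x + a *s y \<in> ?W"
    using x y W by (simp add: subspace_add subspace_scale)
  then have "x + a *s y \<in> U"
    using singular_perp_maximal[OF U] a by (simp add: assms g_def)
  \<comment> \<open>\<open>x\<close> is orthogonal to all of \<open>U\<close>, while the product of
    this vector with \<open>x\<close> is \<open>h x x\<close>.\<close>
  then have "B x (x + a *s y) = 0"
    using x by (auto simp: perp_def)
  then have "B (x + a *s y) x = 0"
    using xV UD(2) \<open>x + a *s y \<in> U\<close> B_eq_0_sym by blast
  moreover have "B (x + a *s y) x = h x x"
    using B_add[of x "a *s y" x] B_scale[of y x a] xV yV subspace_scale[OF subspace_V] hyx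
    by (simp add: assms)
  ultimately show False
    using hx by simp
qed

text \<open>Three extra dimensions in the perp of a maximal \<open>U\<close> are too many. In odd
  characteristic, orthogonal \<open>x\<close>, \<open>y\<close>, \<open>z\<close> combine to a
  singular vector with coefficient 1 at \<open>z\<close>, whose product with \<open>z\<close> is
  \<open>2 * Q z\<close>, not 0. In characteristic 2, \<open>x\<close> and \<open>y\<close> suffice,
  since every element is a square.\<close>

lemma dim_le_quadratic:
  assumes "f = Quadratic Q"
  shows "dim V \<le> 2 * rank + 2"
proof (rule ccontr)
  let ?q = "CARD('a)"
  assume "\<not> dim V \<le> 2 * rank + 2"
  then have "dim V = 2 * rank + ((dim V - 2 * rank - 3) + 3)"
    by simp
  then obtain m where m: "dim V = 2 * rank + (m + 3)"
    by blast
  obtain U where U: "U \<in> polar_subspaces scale V f" "dim U = rank"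
    by (rule rank_attained)
  note UD = polar_subspaceD[OF U(1)]
  let ?W = "perp V f U"
  have q: "1 < ?q"
    using card_field_ge_2[where 'a='a] by simp
  have U0: "card U > 0"
    using UD(3) subspace_0[OF UD(1)] by (auto simp: card_gt_0_iff)
  have W: "subspace ?W" "?W \<subseteq> V" "finite ?W"
    using subspace_perp[OF UD(2)] perp_subset finite_perp by auto
  have less_q: "c < ?q * c" if "c > 0" for c
    using that q by simp
  have cardW: "?q * (?q * (?q * card U)) \<le> card ?W"
    using card_perp_maximal[OF U m] q by (simp add: power_add power3_eq_cube)
  have less: "card U < ?q * card U" "?q * card U < ?q * (?q * card U)"
    "?q * (?q * card U) < ?q * (?q * (?q * card U))"
    using less_q U0 by auto
  from less have "card U < card ?W"
    using cardW by linarith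
  then obtain x where x: "x \<in> ?W" "x \<notin> U"
    using not_subset_of_card_less UD(3) by blast
  have xV: "x \<in> V"
    using x W by blast
  let ?W1 = "{y \<in> ?W. B y x = 0}"
  have W1: "subspace ?W1" "?W1 \<subseteq> V" "finite ?W1"
    using W subspace_perp_inter[OF W(1,2) xV] by auto
  have "?q * (?q * (?q * card U)) \<le> ?q * card ?W1"
    using cardW card_perp_inter_le[OF W(1,2) xV] by linarith
  then have cardW1: "?q * (?q * card U) \<le> card ?W1"
    by simp
  \<comment> \<open>In characteristic 2 the vector \<open>x\<close> is orthogonal to itself, so
    \<open>y\<close> must be kept out of the span of \<open>x\<close> and \<open>U\<close>, not only
    out of \<open>U\<close>.\<close>
  have "card (span (insert x U)) < card ?W1"
    unfolding card_span_insert[OF UD(1) x(2)] using cardW1 less(2) by linarith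
  moreover have "finite (span (insert x U))"
    using UD(3) by (simp add: finite_span)
  ultimately obtain y where y: "y \<in> ?W1" "y \<notin> span (insert x U)"
    using not_subset_of_card_less by blast
  have yV: "y \<in> V"
    using y W by blast
  have yU: "y \<notin> U"
    using y(2) span_base by blast
  have Qx: "Q x \<noteq> 0" and Qy: "Q y \<noteq> 0"
    using singular_perp_maximal[OF U] x y yU by (auto simp: assms)
  have Byx: "B y x = 0" "B x y = 0"
    using y(1) B_eq_0_sym[OF yV xV] by auto
  have Q_scale: "Q (a *s v) = a ^ 2 * Q v" if "v \<in> V" for a v
    using form_on_V that by (simp add: assms)
  have Q_add: "Q (v + w) = Q v + Q w" if "B v w = 0" for v w
    using that by (simp add: assms algebra_simps)
  have Bscale: "B (a *s v) w = 0" if "B v w = 0" "v \<in> V" "w \<in> V" for a v w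
    using that B_scale by simp
  show False
  proof (cases "(2::'a) = 0")
    case True
    then obtain a where a: "a ^ 2 = - Q y / Q x"
      using power2_surj_of_char_2 by (metis surjE)
    have ax: "a *s x \<in> V"
      using xV subspace_V by (simp add: subspace_scale)
    have "Q (a *s x + y) = Q (a *s x) + Q y"
      using Bscale Byx xV yV by (intro Q_add) auto
    also have "\<dots> = 0"
      using a Qx by (simp add: Q_scale[OF xV])
    finally have "singular f (a *s x + y)"
      by (simp add: assms)
    moreover have "a *s x + y \<in> ?W"
      using x y W by (simp add: subspace_add subspace_scale)
    ultimately have "a *s x + y \<in> U"
      using singular_perp_maximal[OF U] by blast
    then have "(a *s x + y) - a *s x \<in> span (insert x U)"
      by (intro span_diff span_scale) (auto intro: span_base)
    then show False
      using y(2) by simp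
  next
    case False
    let ?W2 = "{z \<in> ?W1. B z y = 0}"
    have "?q * (?q * card U) \<le> ?q * card ?W2"
      using cardW1 card_perp_inter_le[OF W1(1,2) yV] by linarith
    then have "?q * card U \<le> card ?W2"
      by simp
    then have "card U < card ?W2"
      using less_q[OF U0] by linarith
    then obtain z where z: "z \<in> ?W2" "z \<notin> U"
      using not_subset_of_card_less UD(3) by blast
    have zV: "z \<in> V" and zW: "z \<in> ?W"
      using z W by auto
    have Bz: "B x z = 0" "B y z = 0"
      using z(1) B_eq_0_sym zV xV yV by blast+
    obtain a b where ab: "Q x * a ^ 2 + Q y * b ^ 2 = - Q z"
      using exists_diagonal_representation[OF Qx Qy] by metis
    have V: "a *s x \<in> V" "b *s y \<in> V" "a *s x + b *s y \<in> V"
      using xV yV subspace_V by (simp_all add: subspace_scale subspace_add)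
    let ?w = "a *s x + b *s y + z"
    have Babz: "B (a *s x + b *s y) z = 0"
      using V zV xV yV Bz Bscale B_add by simp
    have "B y (a *s x) = 0"
      using Bscale[OF Byx(2) xV yV] V yV B_eq_0_sym by blast
    then have "B (a *s x) (b *s y) = 0"
      using Bscale[of y "a *s x" b] V yV B_eq_0_sym by blast
    then have "Q ?w = Q (a *s x) + Q (b *s y) + Q z"
      using Q_add Babz by simp
    also have "\<dots> = 0"
      using ab by (simp add: Q_scale xV yV algebra_simps)
    finally have "singular f ?w"
      by (simp add: assms)
    moreover have wW: "?w \<in> ?W"
      using x y zW W by (simp add: subspace_add subspace_scale)
    ultimately have "?w \<in> U"
      using singular_perp_maximal[OF U] by blast
    then have "B z ?w = 0"
      using zW by (auto simp: perp_def)
    then have "B ?w z = 0"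
      using B_eq_0_sym[OF zV] wW W(2) by blast
    then have "B z z = 0"
      using B_add[OF V(3) zV zV] Babz by simp
    moreover have "B z z = 2 * Q z"
    proof -
      have "Q (z + z) = Q ((1 + 1) *s z)"
        unfolding scale_left_distrib by simp
      also have "\<dots> = (1 + 1) ^ 2 * Q z"
        using Q_scale[OF zV] .
      finally show ?thesis
        by (simp add: assms power2_eq_square)
    qed
    ultimately have "Q z = 0"
      using False by simp
    then show False
      using singular_perp_maximal[OF U zW] z by (simp add: assms)
  qed
qed

lemma nondegenerate_on_iff: "nondegenerate_on W f \<longleftrightarrow> {x \<in> perp W f W. singular f x} = {0}"
proof (cases f)
  case (Hermitian h)
  have "perp W f W = {x \<in> perp W f W. singular f x}"
    by (auto simp: Hermitian perp_def)
  then show ?thesis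
    by (simp add: Hermitian)
qed auto

text \<open>The bounds leave two dimensions for a Hermitian form and three for a quadratic one, and
  each of them belongs to a type.\<close>

lemma classical_polar_space_of_not_alternating:
  assumes "\<And>\<beta>. f \<noteq> Alternating \<beta>"
  obtains ty where "classical_polar_space scale V f rank ty"
proof -
  have "\<exists>ty \<in> type_kind f. dim V = type_dim ty rank"
  proof (cases f)
    case (Alternating \<beta>)
    then show ?thesis
      using assms by blast
  next
    case (Hermitian h)
    have "dim V = 2 * rank \<or> dim V = 2 * rank + 1"
      using two_rank_le_dim dim_le_hermitian[OF Hermitian] by auto
    then show ?thesis
      by (auto simp: Hermitian)
  next
    case (Quadratic Q)
    have "dim V = 2 * rank \<or> dim V = 2 * rank + 1 \<or> dim V = 2 * rank + 2"
      using two_rank_le_dim dim_le_quadratic[OF Quadratic] by auto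
    then show ?thesis
      by (auto simp: Quadratic)
  qed
  then obtain ty where ty: "ty \<in> type_kind f" "dim V = type_dim ty rank"
    by blast
  have "\<exists>C. finite C \<and> span C = V"
    using finite_basis subspace_V finite_V by metis
  then have "classical_polar_space scale V f rank ty"
    using ty subspace_V form_on_V nondegenerate_V by unfold_locales auto
  then show thesis
    by (rule that)
qed

lemma restriction_polar_subspaces:
  assumes "H \<subseteq> V"
  shows "restriction (polar_subspaces scale V f) H = polar_subspaces scale H f"
  using assms by (auto simp: restriction_def polar_subspaces_def)

end

section \<open>Nondegenerate hyperplanes\<close>

locale hyperplane_section = nondegenerate_form_space scale V f
  for scale :: "'a::{field,finite} \<Rightarrow> 'b::ab_group_add \<Rightarrow> 'b"  (infixr \<open>*s\<close> 75)
    and V :: "'b set" and f :: "('a, 'b) form" +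
  fixes H :: "'b set"
  assumes hyperplane_H: "hyperplane scale V H"
    and nondegenerate_H: "\<not> degenerate_hyperplane scale V f H"
begin

lemma H_subspace: "subspace H" and H_subset: "H \<subseteq> V" and dim_H: "dim V = dim H + 1"
  using hyperplane_H by (auto simp: hyperplane_def)

lemma finite_H: "finite H"
  using finite_subset[OF H_subset finite_V] .

lemma card_V_eq: "card V = CARD('a) * card H"
  using subspace_V finite_V H_subspace finite_H by (simp add: card_subspace dim_H)

text \<open>A nonzero such \<open>x\<close> would span a singular point whose perp contains
  \<open>H\<close> and, by \<open>card_perp\<close>, has the same size, making \<open>H\<close>
  degenerate.\<close>

lemma singular_perp_H_eq_0:
  assumes x: "x \<in> V" "singular f x" "\<And>y. y \<in> H \<Longrightarrow> B y x = 0"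
  shows "x = 0"
proof (rule ccontr)
  assume "x \<noteq> 0"
  let ?P = "span (insert x {0})"
  have "perp V f {0} = V"
    using B_zero B_eq_0_sym subspace_0[OF subspace_V] by (auto simp: perp_def)
  then have P: "?P \<in> polar_subspaces scale V f" and perp: "perp V f ?P = {y \<in> V. B y x = 0}"
    using span_insert_polar[OF zero_polar_subspace] perp_span_insert[of "{0}" x] x subspace_0[OF subspace_V]
    by auto
  have dimP: "dim ?P = 1" and cardP: "card ?P = CARD('a)"
    using dim_span_insert[of "{0}" x] card_span_insert[of "{0}" x] \<open>x \<noteq> 0\<close>
      dim_eq_iff_card[of "{0}" 0] by auto
  have "H = perp V f ?P"
  proof (rule card_subset_eq)
    show "finite (perp V f ?P)"
      by (rule finite_perp)
    show "H \<subseteq> perp V f ?P"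
      unfolding perp using H_subset x(3) by blast
    show "card H = card (perp V f ?P)"
      using card_perp[OF P] card_V_eq cardP by simp
  qed
  with P dimP have "degenerate_hyperplane scale V f H"
    using hyperplane_H unfolding degenerate_hyperplane_def by blast
  with nondegenerate_H show False ..
qed

text \<open>By \<open>card_perp_mult\<close> the perp of \<open>H\<close> has as many elements as
  the field, so it contains a nonzero vector. For an alternating form that vector is singular,
  against \<open>singular_perp_H_eq_0\<close>.\<close>

lemma not_alternating: "f \<noteq> Alternating \<beta>"
proof
  assume f: "f = Alternating \<beta>"
  have "card (perp V f H) * card H = CARD('a) * card H"
    unfolding card_V_eq[symmetric]
  proof (rule card_perp_mult[OF H_subspace H_subset])
    fix x
    assume "x \<in> H" "x \<noteq> 0"
    then show "\<exists>v\<in>V. B v x \<noteq> 0"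
      using singular_radical_eq_0[of x] H_subset by (auto simp: f)
  qed
  moreover have "card H \<noteq> 0"
    using finite_H subspace_0[OF H_subspace] by auto
  ultimately have "card {0} < card (perp V f H)"
    using card_field_ge_2[where 'a='a] by simp
  then obtain x where "x \<in> perp V f H" "x \<noteq> 0"
    using not_subset_of_card_less[of "{0}"] by blast
  then have "x \<in> V" "\<And>y. y \<in> H \<Longrightarrow> B y x = 0"
    using B_eq_0_sym H_subset by (auto simp: perp_def)
  then have "x = 0"
    by (intro singular_perp_H_eq_0) (auto simp: f)
  with \<open>x \<noteq> 0\<close> show False ..
qed

sublocale H: nondegenerate_form_space scale H f
proof
  show "subspace H" "finite H"
    by (fact H_subspace finite_H)+
  show "is_form_on scale H f"
    using form_on_V H_subset by (rule is_form_on_subset)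
  have "x = 0" if "x \<in> perp H f H" "singular f x" for x
  proof (rule singular_perp_H_eq_0)
    fix y
    assume "y \<in> H"
    then show "B y x = 0"
      using that H_subset by (auto simp: perp_def intro: B_eq_0_sym[of x y])
  qed (use that H_subset in \<open>auto simp: perp_def\<close>)
  moreover have "0 \<in> perp H f H" "singular f 0"
    using polar_subspaceD(4)[OF zero_polar_subspace] subspace_0[OF H_subspace] B_zero H_subset
    by (auto simp: perp_def)
  ultimately show "nondegenerate_on H f"
    unfolding nondegenerate_on_iff by blast
qed

lemma rank_H_le: "H.rank \<le> rank"
proof -
  obtain U where "U \<in> polar_subspaces scale H f" "dim U = H.rank"
    by (rule H.rank_attained)
  then show ?thesis
    using dim_le_rank[of U] H_subset by (auto simp: polar_subspaces_def)
qed

lemma rank_le_rank_H: "rank \<le> H.rank + 1"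
proof -
  obtain U where U: "U \<in> polar_subspaces scale V f" "dim U = rank"
    by (rule rank_attained)
  note UD = polar_subspaceD[OF U(1)]
  have UH: "subspace (U \<inter> H)" "finite (U \<inter> H)"
    using UD H_subspace by (auto simp: subspace_inter)
  have "U \<inter> H \<in> polar_subspaces scale V f"
    using U(1) UH(1) by (rule polar_subspace_subset) auto
  then have "U \<inter> H \<in> polar_subspaces scale H f"
    unfolding restriction_polar_subspaces[OF H_subset, symmetric] restriction_def by blast
  then have "dim (U \<inter> H) \<le> H.rank"
    by (rule H.dim_le_rank)
  moreover have "card U \<le> CARD('a) * card (U \<inter> H)"
  proof (cases "U \<subseteq> H")
    case True
    then show ?thesis
      by (simp add: Int_absorb2)
  next
    case False
    then show ?thesis
      using card_inter_hyperplane[OF hyperplane_H subspace_V finite_V UD(1,2)] by simp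
  qed
  then have "CARD('a) ^ rank \<le> CARD('a) ^ (dim (U \<inter> H) + 1)"
    using UD UH U(2) by (simp add: card_subspace)
  then have "rank \<le> dim (U \<inter> H) + 1"
    by (rule power_le_imp_le_exp[rotated]) (use card_field_ge_2[where 'a='a] in simp)
  ultimately show ?thesis
    by simp
qed

end

section \<open>Designs\<close>

locale design_space = nondegenerate_form_space scale V f
  for scale :: "'a::{field,finite} \<Rightarrow> 'b::ab_group_add \<Rightarrow> 'b"  (infixr \<open>*s\<close> 75)
    and V :: "'b set" and f :: "('a, 'b) form" +
  fixes t k l :: nat and D :: "'b set set"
  assumes design_D: "design scale (polar_subspaces scale V f) t k l D"
    and t_pos: "1 \<le> t"
begin

lemma block: "C \<in> D \<Longrightarrow> C \<in> polar_subspaces scale V f" "C \<in> D \<Longrightarrow> dim C = k"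
  using design_D by (auto simp: design_def)

lemma finite_D: "finite D"
  by (rule finite_subset[OF _ finite_polar_subspaces]) (use block in blast)

lemma card_block: "C \<in> D \<Longrightarrow> card C = CARD('a) ^ k"
  using block[of C] polar_subspaceD[of C] by (simp add: card_subspace)

text \<open>Each \<open>x\<close> in \<open>S\<close> spans with \<open>T\<close> a subspace of
  dimension \<open>t\<close>, which lies in \<open>l\<close> blocks. Leaving \<open>S\<close> free
  gives both the count in \<open>V\<close> and the count in \<open>H\<close>.\<close>

lemma sum_card_block_inter:
  assumes T: "T \<in> polar_subspaces scale V f" "dim T = t - 1"
    and S: "S \<subseteq> {x \<in> perp V f T. singular f x} - T"
  shows "(\<Sum>C\<in>{C \<in> D. T \<subseteq> C}. card (S \<inter> C)) = l * card S"
proof -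
  have finS: "finite S"
    using S finite_perp finite_subset[of S] by blast
  have "(\<Sum>x\<in>S. card {C \<in> {C \<in> D. T \<subseteq> C}. x \<in> C}) = (\<Sum>C\<in>{C \<in> D. T \<subseteq> C}. card {x \<in> S. x \<in> C})"
    by (rule sum_multicount_gen) (use finS finite_D in auto)
  moreover have "card {C \<in> {C \<in> D. T \<subseteq> C}. x \<in> C} = l" if "x \<in> S" for x
  proof -
    have x: "x \<in> perp V f T" "singular f x" "x \<notin> T"
      using S that by auto
    have "span (insert x T) \<subseteq> C \<longleftrightarrow> insert x T \<subseteq> C" if "C \<in> D" for C
      using polar_subspaceD(1)[OF block(1)[OF that]] span_superset[of "insert x T"]
        span_minimal[of "insert x T" C] by blast
    then have "{C \<in> {C \<in> D. T \<subseteq> C}. x \<in> C} = {C \<in> D. span (insert x T) \<subseteq> C}"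
      by auto
    moreover have "dim (span (insert x T)) = t"
      using polar_subspaceD[OF T(1)] T(2) x t_pos by (subst dim_span_insert) auto
    ultimately show ?thesis
      using design_D span_insert_polar[OF T(1) x(1,2)] by (simp add: design_def)
  qed
  moreover have "{x \<in> S. x \<in> C} = S \<inter> C" for C
    by blast
  ultimately show ?thesis
    by (simp add: mult.commute)
qed

lemma card_singular_Diff:
  assumes "T \<in> polar_subspaces scale V f"
  shows "card ({x \<in> perp V f T. singular f x} - T) + card T = singular_count T"
proof -
  have "T \<subseteq> {x \<in> perp V f T. singular f x}"
    using assms polar_subspace_subset_perp polar_subspaceD by blast
  then show ?thesis
    unfolding singular_count_def using polar_subspaceD(3)[OF assms] finite_perp
    by (subst card_Diff_subset) (auto intro!: le_add_diff_inverse2 card_mono)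
qed

end

locale residual_design = design_space scale V f t k l D + hyperplane_section scale V f H
  for scale :: "'a::{field,finite} \<Rightarrow> 'b::ab_group_add \<Rightarrow> 'b"  (infixr \<open>*s\<close> 75)
    and V :: "'b set" and f :: "('a, 'b) form" and t k l :: nat and D :: "'b set set"
    and H :: "'b set" +
  assumes t_le_k: "t \<le> k"
begin

text \<open>Apply \<open>sum_card_block_inter\<close> to the singular vectors \<open>?X\<close> of
  the perp outside \<open>T\<close>, and to those of them in \<open>H\<close>. A block not inside
  \<open>H\<close> meets \<open>H\<close> in dimension \<open>k - 1\<close>.\<close>

lemma residual_block_count_equations:
  assumes T: "T \<in> polar_subspaces scale H f" "dim T = t - 1"
  defines "a \<equiv> real (card {C \<in> residual D H. T \<subseteq> C})"
    and "b \<equiv> real (card {C \<in> D - residual D H. T \<subseteq> C})"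
    and "q \<equiv> real CARD('a)"
  shows "(a + b) * (q ^ k - q ^ (t - 1)) = real l * (real (singular_count T) - q ^ (t - 1))"
    and "a * (q ^ k - q ^ (t - 1)) + b * (q ^ (k - 1) - q ^ (t - 1)) =
      real l * (real (H.singular_count T) - q ^ (t - 1))"
proof -
  have TV: "T \<in> polar_subspaces scale V f" and TH: "T \<subseteq> H"
    using T(1) H_subset by (auto simp: polar_subspaces_def)
  note TD = polar_subspaceD[OF TV]
  have cardT: "card T = CARD('a) ^ (t - 1)"
    using TD T(2) by (simp add: card_subspace)
  let ?X = "{x \<in> perp V f T. singular f x} - T"
  let ?D1 = "{C \<in> residual D H. T \<subseteq> C}"
  let ?D2 = "{C \<in> D - residual D H. T \<subseteq> C}"
  have D12: "{C \<in> D. T \<subseteq> C} = ?D1 \<union> ?D2" "?D1 \<inter> ?D2 = {}" "finite ?D1" "finite ?D2"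
    using finite_D by (auto simp: residual_def)
  have sum: "(\<Sum>C\<in>?D1. real (card (S \<inter> C))) + (\<Sum>C\<in>?D2. real (card (S \<inter> C))) = real l * real (card S)"
    if "S \<subseteq> ?X" for S
  proof -
    have "real (\<Sum>C\<in>{C \<in> D. T \<subseteq> C}. card (S \<inter> C)) = real (l * card S)"
      using sum_card_block_inter[OF TV T(2) that] by simp
    then show ?thesis
      unfolding D12(1) using D12 by (simp add: sum.union_disjoint)
  qed
  \<comment> \<open>Vectors of a block through \<open>T\<close> are singular and orthogonal to
    \<open>T\<close>, so only \<open>T\<close> itself is removed.\<close>
  have XC: "?X \<inter> C = C - T" if "C \<in> D" "T \<subseteq> C" for C
    using polar_subspaceD[OF block(1)[OF that(1)]] that(2) TD by (auto simp: perp_def)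
  have cardXC: "real (card (?X \<inter> C)) = q ^ k - q ^ (t - 1)" if "C \<in> D" "T \<subseteq> C" for C
  proof -
    have "real (card (C - T)) = real (card C) - real (card T)"
      using that polar_subspaceD(3)[OF block(1)[OF that(1)]] TD(3)
      by (subst card_Diff_subset) (auto intro!: of_nat_diff card_mono)
    then show ?thesis
      unfolding XC[OF that] using card_block[OF that(1)] cardT by (simp add: q_def)
  qed
  have cardXHC: "real (card (?X \<inter> H \<inter> C)) = q ^ (k - 1) - q ^ (t - 1)"
    if C: "C \<in> D" "T \<subseteq> C" "\<not> C \<subseteq> H" for C
  proof -
    note CD = polar_subspaceD[OF block(1)[OF C(1)]]
    have "k \<noteq> 0"
      using t_pos t_le_k by simp
    then have "CARD('a) * CARD('a) ^ (k - 1) = CARD('a) * card (C \<inter> H)"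
      using card_block[OF C(1)] card_inter_hyperplane[OF hyperplane_H subspace_V finite_V CD(1,2) C(3)]
      by (simp flip: power_Suc)
    then have card: "card (C \<inter> H) = CARD('a) ^ (k - 1)"
      by simp
    have "?X \<inter> H \<inter> C = (C \<inter> H) - T"
      using XC[OF C(1,2)] by blast
    moreover have "real (card (C \<inter> H - T)) = real (card (C \<inter> H)) - real (card T)"
      using C TH CD(3) TD(3) by (subst card_Diff_subset) (auto intro!: of_nat_diff card_mono)
    ultimately show ?thesis
      using card cardT by (simp add: q_def)
  qed
  have cardXHC': "real (card (?X \<inter> H \<inter> C)) = q ^ k - q ^ (t - 1)"
    if C: "C \<in> D" "T \<subseteq> C" "C \<subseteq> H" for C
  proof -
    have "?X \<inter> H \<inter> C = ?X \<inter> C"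
      using C by blast
    then show ?thesis
      using cardXC[OF C(1,2)] by simp
  qed
  have "(\<Sum>C\<in>?D1. real (card (?X \<inter> C))) = (\<Sum>C\<in>?D1. q ^ k - q ^ (t - 1))"
    by (rule sum.cong[OF refl], rule cardXC) (auto simp: residual_def)
  moreover have "(\<Sum>C\<in>?D2. real (card (?X \<inter> C))) = (\<Sum>C\<in>?D2. q ^ k - q ^ (t - 1))"
    by (rule sum.cong[OF refl], rule cardXC) auto
  moreover have "real (card ?X) = real (singular_count T) - q ^ (t - 1)"
    using card_singular_Diff[OF TV] cardT by (simp add: q_def flip: of_nat_add of_nat_power)
  ultimately show "(a + b) * (q ^ k - q ^ (t - 1)) = real l * (real (singular_count T) - q ^ (t - 1))"
    using sum[of ?X] by (simp add: a_def b_def distrib_right)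
  have "(\<Sum>C\<in>?D1. real (card (?X \<inter> H \<inter> C))) = (\<Sum>C\<in>?D1. q ^ k - q ^ (t - 1))"
    by (rule sum.cong[OF refl], rule cardXHC') (auto simp: residual_def)
  moreover have "(\<Sum>C\<in>?D2. real (card (?X \<inter> H \<inter> C))) = (\<Sum>C\<in>?D2. q ^ (k - 1) - q ^ (t - 1))"
    by (rule sum.cong[OF refl], rule cardXHC) (auto simp: residual_def)
  moreover have "real (card (?X \<inter> H)) = real (H.singular_count T) - q ^ (t - 1)"
  proof -
    have "{x \<in> perp H f T. singular f x} = {x \<in> perp V f T. singular f x} \<inter> H"
      using H_subset by (auto simp: perp_def)
    then have "H.singular_count T = card (({x \<in> perp V f T. singular f x} \<inter> H - T) \<union> T)"
      unfolding H.singular_count_def using polar_subspace_subset_perp[OF TV] TH TD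
      by (intro arg_cong[of _ _ card]) auto
    also have "\<dots> = card ({x \<in> perp V f T. singular f x} \<inter> H - T) + card T"
      using finite_H TD(3) by (intro card_Un_disjoint) auto
    also have "{x \<in> perp V f T. singular f x} \<inter> H - T = ?X \<inter> H"
      by blast
    finally show ?thesis
      using cardT by (simp add: q_def)
  qed
  ultimately show "a * (q ^ k - q ^ (t - 1)) + b * (q ^ (k - 1) - q ^ (t - 1)) =
      real l * (real (H.singular_count T) - q ^ (t - 1))"
    using sum[of "?X \<inter> H"] by (simp add: a_def b_def Int_lower1)
qed

end

text \<open>Here \<open>A\<close>, \<open>K\<close>, \<open>C\<close>, \<open>E\<close> stand for
  the powers of \<open>q\<close> with exponents \<open>r\<close>, \<open>k\<close>,
  \<open>t - 1\<close> and the type parameter. The two formulas for \<open>z'\<close> are the one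
  for \<open>z\<close> with \<open>E\<close> divided by \<open>q\<close> (rank kept), or with
  \<open>A\<close> divided by \<open>q\<close> and \<open>E\<close> multiplied by \<open>q\<close>
  (rank dropped).\<close>

lemma solve_residual_equations:
  fixes a b q A K C z z' l E :: real
  assumes q: "q > 1" and pos: "A > 0" "K > 0" "C > 0" "K > C"
    and eq1: "(a + b) * (K - C) = l * (z - C)"
    and eq2: "a * (K - C) + b * (K / q - C) = l * (z' - C)"
    and z: "z = A + A ^ 2 * E * (1 / C - 1 / A)"
  shows "z' = A + A ^ 2 * E / q * (1 / C - 1 / A) \<Longrightarrow>
      a = (A / C - 1) / (q - 1) * (A * E / K + 1) / ((K / C - 1) / (q - 1)) * l"
    and "z' = A / q + A ^ 2 * E / q * (1 / C - q / A) \<Longrightarrow>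
      a = (A * E / C + 1) * ((A / K - 1) / (q - 1)) / ((K / C - 1) / (q - 1)) * l"
proof -
  \<comment> \<open>Subtracting the equations eliminates \<open>a\<close>; once \<open>b\<close> is
    known, the first equation gives \<open>a\<close>.\<close>
  have diff: "b * K * (1 - 1 / q) = l * (z - z')"
    using eq1 eq2 by (simp add: algebra_simps)
  have q': "1 - 1 / q \<noteq> 0"
    using q by simp
  have a: "a * (K - C) = l * (z - C) - b * (K - C)"
    using eq1 by (simp add: algebra_simps)
  have z_C: "z - C = (A - C) * (1 + A * E / C)"
    unfolding z using pos by (simp add: field_simps power2_eq_square)
  \<comment> \<open>In both targets the factors \<open>q - 1\<close> of the two
    \<open>q\<close>-numbers cancel.\<close>
  have ratio: "u / (q - 1) * v / ((K / C - 1) / (q - 1)) * l = l * u * v * C / (K - C)" for u v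
  proof -
    have "(K / C - 1) / (q - 1) = (K - C) / (C * (q - 1))"
      using pos q by (simp add: divide_simps)
    then show ?thesis
      using pos q by simp
  qed
  {
    assume z': "z' = A + A ^ 2 * E / q * (1 / C - 1 / A)"
    have "z - z' = (1 - 1 / q) * (A * E * (A / C - 1))"
      unfolding z z' using pos q by (simp add: field_simps power2_eq_square)
    then have "(1 - 1 / q) * (b * K) = (1 - 1 / q) * (l * (A * E * (A / C - 1)))"
      using diff by (simp add: mult_ac)
    then have "b * K = l * (A * E * (A / C - 1))"
      by (rule mult_left_cancel[OF q', THEN iffD1])
    then have b: "b = l * (A * E * (A / C - 1)) / K"
      using pos by (simp add: field_simps)
    have "a * (K - C) = l * (A / C - 1) * (A * E / K + 1) * C"
      unfolding a z_C b using pos by (simp add: field_simps)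
    then show "a = (A / C - 1) / (q - 1) * (A * E / K + 1) / ((K / C - 1) / (q - 1)) * l"
      unfolding ratio using pos by (simp add: eq_divide_eq)
  }
  {
    assume z': "z' = A / q + A ^ 2 * E / q * (1 / C - q / A)"
    have "z - z' = (1 - 1 / q) * (A * (1 + A * E / C))"
      unfolding z z' using pos q by (simp add: field_simps power2_eq_square)
    then have "(1 - 1 / q) * (b * K) = (1 - 1 / q) * (l * (A * (1 + A * E / C)))"
      using diff by (simp add: mult_ac)
    then have "b * K = l * (A * (1 + A * E / C))"
      by (rule mult_left_cancel[OF q', THEN iffD1])
    then have b: "b = l * (A * (1 + A * E / C)) / K"
      using pos by (simp add: field_simps)
    have "a * (K - C) = l * (A / K - 1) * (A * E / C + 1) * C"
      unfolding a z_C b using pos by (simp add: field_simps)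
    then have "a = (A / K - 1) / (q - 1) * (A * E / C + 1) / ((K / C - 1) / (q - 1)) * l"
      unfolding ratio using pos by (simp add: eq_divide_eq)
    then show "a = (A * E / C + 1) * ((A / K - 1) / (q - 1)) / ((K / C - 1) / (q - 1)) * l"
      by (simp only: mult.commute)
  }
qed

section \<open>Counts in terms of rank and type\<close>

sublocale classical_polar_space \<subseteq> nondegenerate_form_space scale V f
proof unfold_locales
  obtain C where "finite C" "span C = V"
    using finite_dimensional_V by blast
  moreover interpret finite_field_vector_space scale ..
  show "finite V"
    using calculation finite_span by blast
qed (fact subspace_V form_on_V nondegenerate_V)+

context classical_polar_space
begin

text \<open>\<open>2 * r + 1 + type_param ty\<close> exceeds the dimension by 1,
  \<open>1 / 2\<close> or 0 for an alternating, Hermitian or quadratic form, and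
  \<open>coset_count f\<close> is the matching power of the field order. So one formula covers all
  types.\<close>

lemma coset_count_mult_card:
  "coset_count f * real (card V) = real CARD('a) powr (2 * real r + 1 + type_param ty)"
proof -
  let ?q = "real CARD('a)"
  have q: "?q > 0"
    by simp
  have V: "real (card V) = ?q powr real (type_dim ty r)"
    using card_subspace[OF subspace_V finite_V] dim_of_type q by (simp add: powr_realpow)
  have c: "coset_count f = ?q powr (2 * real r + 1 + type_param ty - real (type_dim ty r))"
  proof (cases f)
    case (Alternating \<beta>)
    then show ?thesis
      using kind_of_type by simp
  next
    case (Hermitian h)
    then have "ty = U_plus \<or> ty = U_minus"
      using kind_of_type by simp
    then have e: "2 * real r + 1 + type_param ty - real (type_dim ty r) = 1 / 2"
      by auto
    show ?thesis
      unfolding e by (simp add: Hermitian powr_half_sqrt)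
  next
    case (Quadratic Q)
    then have "ty = Omega_plus \<or> ty = Omega \<or> ty = Omega_minus"
      using kind_of_type by simp
    then have e: "2 * real r + 1 + type_param ty - real (type_dim ty r) = 0"
      by auto
    show ?thesis
      unfolding e by (simp add: Quadratic)
  qed
  show ?thesis
    unfolding V c by (simp flip: powr_add)
qed

lemma singular_count_classical:
  assumes "T \<in> polar_subspaces scale V f"
  shows "real (singular_count T) = real CARD('a) ^ r +
    (real CARD('a) ^ r) ^ 2 * real CARD('a) powr type_param ty *
      (1 / real CARD('a) ^ dim T - 1 / real CARD('a) ^ r)"
proof -
  have "coset_count f * real (card V) / real CARD('a) =
      (real CARD('a) ^ r) ^ 2 * real CARD('a) powr type_param ty"
  proof -
    have "real CARD('a) powr (2 * real r + 1 + type_param ty) =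
        real CARD('a) powr real (2 * r) * real CARD('a) * real CARD('a) powr type_param ty"
      by (simp add: powr_add)
    also have "real CARD('a) powr real (2 * r) = (real CARD('a) ^ r) ^ 2"
      by (subst powr_realpow) (auto simp: power_even_eq)
    finally show ?thesis
      unfolding coset_count_mult_card by simp
  qed
  then show ?thesis
    using singular_count_formula[OF assms] rank_V card_subspace polar_subspaceD[OF assms] by simp
qed

end

text \<open>Within a kind, the dimension minus the parameter is \<open>2 * r\<close> plus a constant
  (\<open>1 / 2\<close> for Hermitian, 1 for quadratic forms). Losing one dimension thus lowers the
  parameter by 1, and losing one from the rank raises it by 2.\<close>

lemma type_param_section:
  assumes "ty \<in> type_kind f" "ty' \<in> type_kind f" "\<And>\<beta>. f \<noteq> Alternating \<beta>"
    and dim: "type_dim ty r = type_dim ty' r' + 1" and r: "r' = r \<or> r = r' + 1"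
  shows "type_param ty' = (if r' = r then type_param ty - 1 else type_param ty + 1)"
proof -
  have parity: "2 * m \<noteq> Suc (2 * n)" "Suc (2 * m) \<noteq> 2 * n" for m n :: nat
    by presburger+
  have "ty \<in> {U_plus, U_minus} \<and> ty' \<in> {U_plus, U_minus} \<or>
      ty \<in> {Omega_plus, Omega, Omega_minus} \<and> ty' \<in> {Omega_plus, Omega, Omega_minus}"
    using assms(1-3) by (cases f) auto
  then show ?thesis
    using dim r by (auto simp: parity)
qed

theorem theorem7:
  fixes scale :: "'a::{field,finite} \<Rightarrow> 'b::ab_group_add \<Rightarrow> 'b"
    and V H :: "'b set" and f :: "('a, 'b) form" and ty :: polar_type
    and r t k l q :: nat and \<epsilon> :: real and D :: "'b set set"
  assumes "classical_polar_space scale V f r ty"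
    and "q = CARD('a)" and "\<epsilon> = type_param ty"
    and "1 \<le> r" and "1 \<le> t" and "t \<le> k" and "k \<le> r"
    and "design scale (polar_subspaces scale V f) t k l D"
    and "hyperplane scale V H" and "\<not> degenerate_hyperplane scale V f H"
  shows "\<exists>r' ty' l'.
    classical_polar_space scale H f r' ty' \<and>
    polar_subspaces scale H f = restriction (polar_subspaces scale V f) H \<and>
    r' \<in> {r, r - 1} \<and>
    design scale (restriction (polar_subspaces scale V f) H) (t - 1) k l' (residual D H) \<and>
    real l' =
      (if r' = r
       then q_number q (r - t + 1) * (real q powr (real r - real k + \<epsilon>) + 1)
              / q_number q (k - t + 1) * real l
       else (real q powr (real r - real t + 1 + \<epsilon>) + 1) * q_number q (r - k)
              / q_number q (k - t + 1) * real l)"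
proof -
  interpret classical_polar_space scale V f r ty
    by fact
  interpret residual_design scale V f t k l D H
    by unfold_locales (use assms in auto)
  obtain ty' where ty': "classical_polar_space scale H f H.rank ty'"
    using H.classical_polar_space_of_not_alternating not_alternating by blast
  interpret H': classical_polar_space scale H f "H.rank" ty'
    by fact
  have r': "H.rank = r \<or> r = H.rank + 1"
    using rank_H_le rank_le_rank_H rank_V by linarith
  have param: "type_param ty' = (if H.rank = r then \<epsilon> - 1 else \<epsilon> + 1)"
    using type_param_section[OF kind_of_type H'.kind_of_type not_alternating _ r']
      dim_of_type H'.dim_of_type dim_H by (simp add: assms(3))
  let ?Q = "real q"
  let ?rhs = "if H.rank = r
     then q_number q (r - t + 1) * (?Q powr (real r - real k + \<epsilon>) + 1) / q_number q (k - t + 1) * real l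
     else (?Q powr (real r - real t + 1 + \<epsilon>) + 1) * q_number q (r - k) / q_number q (k - t + 1) * real l"
  have Q: "?Q > 1"
    using card_field_ge_2[where 'a='a] by (simp add: \<open>q = CARD('a)\<close>)
  have powr: "?Q powr (real m - real n + \<epsilon>) = ?Q ^ m * ?Q powr \<epsilon> / ?Q ^ n" for m n :: nat
    using Q by (simp add: powr_add powr_diff powr_realpow)
  have quot: "q_number q (m - n) = (?Q ^ m / ?Q ^ n - 1) / (?Q - 1)" if "n \<le> m" for m n
    using that Q by (simp add: q_number_def power_diff)
  have count: "real (card {C \<in> residual D H. T \<subseteq> C}) = ?rhs"
    if T: "T \<in> polar_subspaces scale H f" "dim T = t - 1" for T
  proof -
    define a where "a = real (card {C \<in> residual D H. T \<subseteq> C})"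
    define b where "b = real (card {C \<in> D - residual D H. T \<subseteq> C})"
    define E where "E = ?Q powr \<epsilon>"
    have TV: "T \<in> polar_subspaces scale V f"
      using T(1) H_subset by (auto simp: polar_subspaces_def)
    have zV: "real (singular_count T) =
        ?Q ^ r + (?Q ^ r) ^ 2 * E * (1 / ?Q ^ (t - 1) - 1 / ?Q ^ r)"
      using singular_count_classical[OF TV] T(2) by (simp add: assms(2,3) E_def)
    have zH: "real (H.singular_count T) = ?Q ^ H.rank +
        (?Q ^ H.rank) ^ 2 * ?Q powr type_param ty' * (1 / ?Q ^ (t - 1) - 1 / ?Q ^ H.rank)"
      using H'.singular_count_classical[OF T(1)] T(2) by (simp add: assms(2))
    have k: "?Q ^ (k - 1) = ?Q ^ k / ?Q"
      using Q assms(5,6) by (simp add: power_diff)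
    have pos: "?Q ^ r > 0" "?Q ^ k > 0" "?Q ^ (t - 1) > 0" "?Q ^ k > ?Q ^ (t - 1)"
      using Q assms(5,6) by (auto intro!: power_strict_increasing)
    note eqs = residual_block_count_equations[OF T, folded a_def b_def assms(2), unfolded k]
    note solve = solve_residual_equations[OF Q pos eqs zV]
    \<comment> \<open>Since \<open>t\<close> is positive, both \<open>q\<close>-number indices are
      differences with \<open>t - 1 = dim T\<close>, the exponent occurring in the counts.\<close>
    have km: "k - t + 1 = k - (t - 1)" "r - t + 1 = r - (t - 1)"
      using assms(5-7) by auto
    have rt: "real r - real t + 1 + \<epsilon> = real r - real (t - 1) + \<epsilon>"
      using assms(5) by (simp add: of_nat_diff)
    show ?thesis
    proof (cases "H.rank = r")
      case True
      have "?Q powr type_param ty' = E / ?Q"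
        using True Q by (simp add: param powr_diff E_def)
      then have "a = (?Q ^ r / ?Q ^ (t - 1) - 1) / (?Q - 1) * (?Q ^ r * E / ?Q ^ k + 1) /
          ((?Q ^ k / ?Q ^ (t - 1) - 1) / (?Q - 1)) * real l"
        using zH True by (intro solve(1)) simp
      moreover have "q_number q (r - t + 1) = (?Q ^ r / ?Q ^ (t - 1) - 1) / (?Q - 1)"
        "q_number q (k - t + 1) = (?Q ^ k / ?Q ^ (t - 1) - 1) / (?Q - 1)"
        unfolding km using assms(5-7) by (intro quot; simp)+
      ultimately show ?thesis
        using True by (simp add: powr a_def E_def)
    next
      case False
      then have r: "r = H.rank + 1"
        using r' by simp
      have "?Q powr type_param ty' = E * ?Q"
        using False Q by (simp add: param powr_add E_def)
      then have "real (H.singular_count T) = ?Q ^ r / ?Q +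
          (?Q ^ r) ^ 2 * E / ?Q * (1 / ?Q ^ (t - 1) - ?Q / ?Q ^ r)"
        using zH Q by (simp add: r power2_eq_square)
      then have "a = (?Q ^ r * E / ?Q ^ (t - 1) + 1) * ((?Q ^ r / ?Q ^ k - 1) / (?Q - 1)) /
          ((?Q ^ k / ?Q ^ (t - 1) - 1) / (?Q - 1)) * real l"
        by (rule solve(2))
      \<comment> \<open>For \<open>k = r\<close> this factor is 0, in agreement with
        \<open>H\<close> then having no totally singular subspace of dimension
        \<open>k\<close>.\<close>
      moreover have "q_number q (r - k) = (?Q ^ r / ?Q ^ k - 1) / (?Q - 1)"
        "q_number q (k - t + 1) = (?Q ^ k / ?Q ^ (t - 1) - 1) / (?Q - 1)"
        unfolding km using assms(5-7) by (intro quot; simp)+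
      ultimately show ?thesis
        using False unfolding rt powr by (simp add: a_def E_def)
    qed
  qed
  \<comment> \<open>The formula gives a real number. A totally singular subspace of dimension
    \<open>t - 1\<close> exists in \<open>H\<close> because \<open>t - 1 \<le> r - 1\<close>, and
    its block count supplies the natural number \<open>l'\<close>.\<close>
  obtain T where T: "T \<in> polar_subspaces scale H f" "dim T = t - 1"
  proof -
    obtain U where U: "U \<in> polar_subspaces scale H f" "dim U = H.rank"
      by (rule H.rank_attained)
    note UD = H.polar_subspaceD[OF U(1)]
    have "t - 1 \<le> dim U"
      using r' assms(5-7) U(2) by linarith
    then obtain T where "subspace T" "T \<subseteq> U" "dim T = t - 1"
      using subspace_of_dim_exists UD by metis
    then show thesis
      using that H.polar_subspace_subset[OF U(1)] by blast
  qed
  define l' where "l' = card {C \<in> residual D H. T \<subseteq> C}"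
  have l': "real l' = ?rhs"
    unfolding l'_def by (rule count[OF T])
  have "design scale (polar_subspaces scale H f) (t - 1) k l' (residual D H)"
    unfolding design_def
  proof (intro conjI ballI impI)
    show "residual D H \<subseteq> {C \<in> polar_subspaces scale H f. dim C = k}"
      using block unfolding residual_def restriction_polar_subspaces[OF H_subset, symmetric]
      by (auto simp: restriction_def)
    fix S
    assume "S \<in> polar_subspaces scale H f" "dim S = t - 1"
    then have "real (card {C \<in> residual D H. S \<subseteq> C}) = real l'"
      unfolding l' by (rule count)
    then show "card {C \<in> residual D H. S \<subseteq> C} = l'"
      by (simp only: of_nat_eq_iff)
  qed
  then show ?thesis
    using ty' r' l' unfolding restriction_polar_subspaces[OF H_subset]
    by (intro exI[of _ H.rank] exI[of _ ty'] exI[of _ l']) auto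
qed

end
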